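(* Let $\Sigma$ be a non-totally geodesic PA hypersurface with $(\mathcal V,\theta)$ in a Riemannian manifold $M$, where $\mathcal V$ is a parallel vector field along $\Sigma$. If $\theta$ is constant, then the integral curves of the tangential component of $\mathcal V$ are geodesics of the ambient space $M$. Moreover, the shape operator $A$ of $\Sigma$ satisfies $\det(A)=0$.
   Context: Let $\nabla$ be the Levi-Civita connection of $M$, and let $\mathfrak X(\Sigma)$ be the smooth vector fields tangent to $\Sigma$. A vector field along $\Sigma$ is a smooth section of $TM|_\Sigma$. An orientable hypersurface $\Sigma\subset M$ with unit normal field $\mathcal N$ is a prescribed angle (PA) hypersurface with $(\mathcal V,\theta)$ if $\mathcal V$ is a unit vector field along $\Sigma$, $\theta:\Sigma\to[0,\frac{\pi}{2}]$ is a smooth function, and $\langle\mathcal V,\mathcal N\rangle=\cos\theta$. The field $\mathcal V$ is parallel along $\Sigma$ if $\nabla_X\mathcal V=0$ for all $X\in\mathfrak X(\Sigma)$. The tangential component $\mathcal T$ of $\mathcal V$ is defined by $\mathcal V=\mathcal T+\cos\theta\,\mathcal N$ with $\mathcal T\in\mathfrak X(\Sigma)$. The shape operator is $A(X)=-\nabla_X\mathcal N$. The hypersurface $\Sigma$ is totally geodesic if $A=0$ identically. *)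

theory Defs
  imports "HOL-Analysis.Analysis" "HOL-Library.Function_Algebras"
begin

section \<open>Smooth maps between Euclidean spaces\<close>

text \<open>Only meant for open \<open>S\<close>. In finite dimension, \<open>f\<close> is \<open>C^(k+1)\<close> iff it is differentiable and
  all its directional derivatives are \<open>C^k\<close>.\<close>

primrec Ck_on :: "nat \<Rightarrow> 'a::euclidean_space set \<Rightarrow> ('a \<Rightarrow> 'b::real_normed_vector) \<Rightarrow> bool" where
  "Ck_on 0 S f \<longleftrightarrow> continuous_on S f"
| "Ck_on (Suc k) S f \<longleftrightarrow>
     (\<forall>x\<in>S. f differentiable (at x)) \<and> (\<forall>v. Ck_on k S (\<lambda>x. frechet_derivative f (at x) v))"

definition smooth_on :: "'a::euclidean_space set \<Rightarrow> ('a \<Rightarrow> 'b::real_normed_vector) \<Rightarrow> bool" where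
  "smooth_on S f \<longleftrightarrow> (\<forall>k. Ck_on k S f)"

section \<open>Smooth manifolds\<close>

type_synonym ('m, 'e) chart = "'m set \<times> ('m \<Rightarrow> 'e)"

abbreviation cdom :: "('m, 'e) chart \<Rightarrow> 'm set" where "cdom c \<equiv> fst c"
abbreviation cmap :: "('m, 'e) chart \<Rightarrow> 'm \<Rightarrow> 'e" where "cmap c \<equiv> snd c"
abbreviation cinv :: "('m, 'e) chart \<Rightarrow> 'e \<Rightarrow> 'm" where "cinv c \<equiv> inv_into (fst c) (snd c)"

text \<open>The underlying set is the topspace of a topology, so that one type can carry several manifolds,
  in particular a manifold and its submanifolds. Atlases need not be maximal.\<close>

record ('m, 'e) mfd =
  mtop :: "'m topology"
  atlas :: "('m set \<times> ('m \<Rightarrow> 'e)) set"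

abbreviation pts :: "('m, 'e) mfd \<Rightarrow> 'm set" where "pts M \<equiv> topspace (mtop M)"

definition charts_at :: "('m, 'e) mfd \<Rightarrow> 'm \<Rightarrow> ('m, 'e) chart set" where
  "charts_at M p = {c \<in> atlas M. p \<in> cdom c}"

definition smooth_manifold :: "('m, 'e::euclidean_space) mfd \<Rightarrow> bool" where
  "smooth_manifold M \<longleftrightarrow>
     Hausdorff_space (mtop M) \<and> second_countable (mtop M) \<and>
     (\<forall>c\<in>atlas M. openin (mtop M) (cdom c) \<and> open (cmap c ` cdom c) \<and>
        homeomorphic_map (subtopology (mtop M) (cdom c)) (top_of_set (cmap c ` cdom c)) (cmap c)) \<and>
     (\<Union>c\<in>atlas M. cdom c) = pts M \<and>
     (\<forall>c\<in>atlas M. \<forall>d\<in>atlas M. smooth_on (cmap c ` (cdom c \<inter> cdom d)) (cmap d \<circ> cinv c))"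

definition smooth_fun :: "('m, 'e::euclidean_space) mfd \<Rightarrow> 'm set \<Rightarrow> ('m \<Rightarrow> real) \<Rightarrow> bool" where
  "smooth_fun M U f \<longleftrightarrow> (\<forall>c\<in>atlas M. smooth_on (cmap c ` (U \<inter> cdom c)) (f \<circ> cinv c))"

section \<open>Tangent vectors and vector fields\<close>

text \<open>A tangent vector at \<open>p\<close> is the family of its components in all charts around \<open>p\<close>, which
  transform under chart changes by the Jacobian. The family is set to \<open>0\<close> outside the charts at \<open>p\<close>,
  so that equality of tangent vectors is equality of functions. The operations \<open>+\<close>, \<open>-\<close>, \<open>0\<close> are
  the pointwise ones.\<close>

type_synonym ('m, 'e) tvec = "('m, 'e) chart \<Rightarrow> 'e"

definition tscale :: "real \<Rightarrow> ('m, 'e::euclidean_space) tvec \<Rightarrow> ('m, 'e) tvec" (infixr "\<odot>" 75) where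
  "r \<odot> v = (\<lambda>c. r *\<^sub>R v c)"

definition tangent_space :: "('m, 'e::euclidean_space) mfd \<Rightarrow> 'm \<Rightarrow> ('m, 'e) tvec set" where
  "tangent_space M p = {v.
     (\<forall>c\<in>charts_at M p. \<forall>d\<in>charts_at M p.
        v d = frechet_derivative (cmap d \<circ> cinv c) (at (cmap c p)) (v c)) \<and>
     (\<forall>c. c \<notin> charts_at M p \<longrightarrow> v c = 0)}"

text \<open>The tangent vector at \<open>p\<close> with component \<open>w\<close> in the chart \<open>c\<close>; \<open>coord_vec M c w\<close> is the vector
  field on \<open>cdom c\<close> with constant components \<open>w\<close>, a constant combination of the coordinate fields.\<close>

definition coord_vec :: "('m, 'e::euclidean_space) mfd \<Rightarrow> ('m, 'e) chart \<Rightarrow> 'e \<Rightarrow> 'm \<Rightarrow> ('m, 'e) tvec" where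
  "coord_vec M c w p = (\<lambda>d. if d \<in> charts_at M p
     then frechet_derivative (cmap d \<circ> cinv c) (at (cmap c p)) w else 0)"

text \<open>The derivative of a function \<open>h\<close> along a tangent vector at \<open>p\<close>. By the chain rule it does not
  depend on the choice of the chart.\<close>

definition tderiv :: "('m, 'e::euclidean_space) mfd \<Rightarrow> 'm \<Rightarrow> ('m, 'e) tvec \<Rightarrow>
    ('m \<Rightarrow> 'b::real_normed_vector) \<Rightarrow> 'b" where
  "tderiv M p v h = (let c = (SOME c. c \<in> charts_at M p)
     in frechet_derivative (h \<circ> cinv c) (at (cmap c p)) (v c))"

definition smooth_vf :: "('m, 'e::euclidean_space) mfd \<Rightarrow> 'm set \<Rightarrow> ('m \<Rightarrow> ('m, 'e) tvec) \<Rightarrow> bool" where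
  "smooth_vf M U X \<longleftrightarrow>
     (\<forall>p\<in>U. X p \<in> tangent_space M p) \<and>
     (\<forall>c\<in>atlas M. smooth_on (cmap c ` (U \<inter> cdom c)) (\<lambda>x. X (cinv c x) c))"

definition lie_bracket :: "('m, 'e::euclidean_space) mfd \<Rightarrow> ('m \<Rightarrow> ('m, 'e) tvec) \<Rightarrow>
    ('m \<Rightarrow> ('m, 'e) tvec) \<Rightarrow> 'm \<Rightarrow> ('m, 'e) tvec" where
  "lie_bracket M X Y p = (\<lambda>c. if c \<in> charts_at M p
     then tderiv M p (X p) (\<lambda>q. Y q c) - tderiv M p (Y p) (\<lambda>q. X q c) else 0)"

section \<open>Riemannian metric and Levi-Civita connection\<close>

type_synonym ('m, 'e) metric = "'m \<Rightarrow> ('m, 'e) tvec \<Rightarrow> ('m, 'e) tvec \<Rightarrow> real"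

definition riemannian_manifold :: "('m, 'e::euclidean_space) mfd \<Rightarrow> ('m, 'e) metric \<Rightarrow> bool" where
  "riemannian_manifold M g \<longleftrightarrow> smooth_manifold M \<and>
     (\<forall>p\<in>pts M. \<forall>u\<in>tangent_space M p. \<forall>v\<in>tangent_space M p. \<forall>w\<in>tangent_space M p. \<forall>r.
        g p (u + v) w = g p u w + g p v w \<and> g p (r \<odot> u) w = r * g p u w \<and>
        g p u v = g p v u \<and> (u \<noteq> 0 \<longrightarrow> g p u u > 0)) \<and>
     (\<forall>U X Y. openin (mtop M) U \<and> smooth_vf M U X \<and> smooth_vf M U Y \<longrightarrow>
        smooth_fun M U (\<lambda>p. g p (X p) (Y p)))"

text \<open>A connection is given as a local operator: \<open>nab Y p v\<close> is the derivative of \<open>Y\<close> at \<open>p\<close> in the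
  direction of the tangent vector \<open>v\<close>, for a vector field \<open>Y\<close> that is smooth on some open set
  containing \<open>p\<close>. Since \<open>nab\<close> is a total function, values for other arguments are unspecified.\<close>

type_synonym ('m, 'e) connection =
  "('m \<Rightarrow> ('m, 'e) tvec) \<Rightarrow> 'm \<Rightarrow> ('m, 'e) tvec \<Rightarrow> ('m, 'e) tvec"

definition affine_connection :: "('m, 'e::euclidean_space) mfd \<Rightarrow> ('m, 'e) connection \<Rightarrow> bool" where
  "affine_connection M nab \<longleftrightarrow>
     (\<forall>U Y. openin (mtop M) U \<and> smooth_vf M U Y \<longrightarrow>
        (\<forall>p\<in>U. \<forall>v\<in>tangent_space M p. \<forall>w\<in>tangent_space M p. \<forall>r.
           nab Y p v \<in> tangent_space M p \<and>
           nab Y p (v + w) = nab Y p v + nab Y p w \<and>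
           nab Y p (r \<odot> v) = r \<odot> nab Y p v) \<and>
        (\<forall>Z. smooth_vf M U Z \<longrightarrow> (\<forall>p\<in>U. \<forall>v\<in>tangent_space M p.
           nab (\<lambda>q. Y q + Z q) p v = nab Y p v + nab Z p v)) \<and>
        (\<forall>f. smooth_fun M U f \<longrightarrow> (\<forall>p\<in>U. \<forall>v\<in>tangent_space M p.
           nab (\<lambda>q. f q \<odot> Y q) p v = tderiv M p v f \<odot> Y p + f p \<odot> nab Y p v)) \<and>
        (\<forall>Z. (\<forall>q\<in>U. Z q = Y q) \<longrightarrow> (\<forall>p\<in>U. \<forall>v\<in>tangent_space M p. nab Z p v = nab Y p v)) \<and>
        (\<forall>X. smooth_vf M U X \<longrightarrow> smooth_vf M U (\<lambda>q. nab Y q (X q))))"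

definition levi_civita :: "('m, 'e::euclidean_space) mfd \<Rightarrow> ('m, 'e) metric \<Rightarrow>
    ('m, 'e) connection \<Rightarrow> bool" where
  "levi_civita M g nab \<longleftrightarrow> affine_connection M nab \<and>
     (\<forall>U X Y. openin (mtop M) U \<and> smooth_vf M U X \<and> smooth_vf M U Y \<longrightarrow>
        (\<forall>p\<in>U. nab Y p (X p) - nab X p (Y p) = lie_bracket M X Y p)) \<and>
     (\<forall>U X Y Z. openin (mtop M) U \<and> smooth_vf M U X \<and> smooth_vf M U Y \<and> smooth_vf M U Z \<longrightarrow>
        (\<forall>p\<in>U. tderiv M p (X p) (\<lambda>q. g q (Y q) (Z q)) =
           g p (nab Y p (X p)) (Z p) + g p (Y p) (nab Z p (X p))))"

section \<open>Hypersurfaces\<close>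

text \<open>The differential of the inclusion of \<open>S\<close> into \<open>M\<close>.\<close>

definition incl :: "('m, 'f::euclidean_space) mfd \<Rightarrow> ('m, 'e::euclidean_space) mfd \<Rightarrow> 'm \<Rightarrow>
    ('m, 'f) tvec \<Rightarrow> ('m, 'e) tvec" where
  "incl S M p \<xi> = (\<lambda>c. if c \<in> charts_at M p then tderiv S p \<xi> (cmap c) else 0)"

text \<open>A hypersurface is a subset with a manifold structure of its own whose inclusion is a smooth
  immersion of codimension one. Its topology may be finer than the subspace topology; embedded
  hypersurfaces are the case of equality.\<close>

definition hypersurface :: "('m, 'e::euclidean_space) mfd \<Rightarrow> ('m, 'f::euclidean_space) mfd \<Rightarrow> bool" where
  "hypersurface M S \<longleftrightarrow> smooth_manifold S \<and> DIM('e) = DIM('f) + 1 \<and> pts S \<subseteq> pts M \<and>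
     continuous_map (mtop S) (mtop M) (\<lambda>p. p) \<and>
     (\<forall>s\<in>atlas S. \<forall>c\<in>atlas M. smooth_on (cmap s ` (cdom s \<inter> cdom c)) (cmap c \<circ> cinv s)) \<and>
     (\<forall>p\<in>pts S. inj_on (incl S M p) (tangent_space S p))"

text \<open>Smooth sections of the restriction of the tangent bundle of \<open>M\<close> to \<open>S\<close>.\<close>

definition smooth_vf_along :: "('m, 'e::euclidean_space) mfd \<Rightarrow> ('m, 'f::euclidean_space) mfd \<Rightarrow>
    ('m \<Rightarrow> ('m, 'e) tvec) \<Rightarrow> bool" where
  "smooth_vf_along M S V \<longleftrightarrow>
     (\<forall>p\<in>pts S. V p \<in> tangent_space M p) \<and>
     (\<forall>s\<in>atlas S. \<forall>c\<in>atlas M.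
        smooth_on (cmap s ` (cdom s \<inter> cdom c)) (\<lambda>x. V (cinv s x) c))"

definition unit_normal :: "('m, 'e::euclidean_space) mfd \<Rightarrow> ('m, 'e) metric \<Rightarrow>
    ('m, 'f::euclidean_space) mfd \<Rightarrow> ('m \<Rightarrow> ('m, 'e) tvec) \<Rightarrow> bool" where
  "unit_normal M g S N \<longleftrightarrow> smooth_vf_along M S N \<and>
     (\<forall>p\<in>pts S. g p (N p) (N p) = 1 \<and>
        (\<forall>\<xi>\<in>tangent_space S p. g p (N p) (incl S M p \<xi>) = 0))"

text \<open>The covariant derivative at \<open>p\<close>, in the direction of a vector tangent to \<open>S\<close>, of a vector field
  along \<open>S\<close>. If \<open>V\<close> is the combination of the coordinate fields \<open>E_i\<close> of the chart \<open>c\<close> with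
  coefficients \<open>V^i\<close> (functions on \<open>S\<close>), the derivative is the sum of the
  \<open>\<xi>(V^i) E_i + V^i(p) \<nabla>_\<xi> E_i\<close>; the last terms add up to the derivative of the constant-component
  field with value \<open>V p\<close> at \<open>p\<close>.\<close>

definition cov_along :: "('m, 'e::euclidean_space) mfd \<Rightarrow> ('m, 'e) connection \<Rightarrow>
    ('m, 'f::euclidean_space) mfd \<Rightarrow> ('m \<Rightarrow> ('m, 'e) tvec) \<Rightarrow> 'm \<Rightarrow> ('m, 'f) tvec \<Rightarrow> ('m, 'e) tvec" where
  "cov_along M nab S V p \<xi> = (\<lambda>c. if c \<in> charts_at M p
     then tderiv S p \<xi> (\<lambda>q. V q c) + nab (coord_vec M c (V p c)) p (incl S M p \<xi>) c
     else 0)"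

definition parallel_along :: "('m, 'e::euclidean_space) mfd \<Rightarrow> ('m, 'e) connection \<Rightarrow>
    ('m, 'f::euclidean_space) mfd \<Rightarrow> ('m \<Rightarrow> ('m, 'e) tvec) \<Rightarrow> bool" where
  "parallel_along M nab S V \<longleftrightarrow>
     (\<forall>X. smooth_vf S (pts S) X \<longrightarrow> (\<forall>p\<in>pts S. cov_along M nab S V p (X p) = 0))"

text \<open>The shape operator at \<open>p\<close>, as an endomorphism of the tangent space of \<open>S\<close>.\<close>

definition shape_operator :: "('m, 'e::euclidean_space) mfd \<Rightarrow> ('m, 'e) connection \<Rightarrow>
    ('m, 'f::euclidean_space) mfd \<Rightarrow> ('m \<Rightarrow> ('m, 'e) tvec) \<Rightarrow> 'm \<Rightarrow> ('m, 'f) tvec \<Rightarrow> ('m, 'f) tvec" where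
  "shape_operator M nab S N p \<xi> =
     (THE \<eta>. \<eta> \<in> tangent_space S p \<and> incl S M p \<eta> = - cov_along M nab S N p \<xi>)"

definition totally_geodesic :: "('m, 'e::euclidean_space) mfd \<Rightarrow> ('m, 'e) connection \<Rightarrow>
    ('m, 'f::euclidean_space) mfd \<Rightarrow> ('m \<Rightarrow> ('m, 'e) tvec) \<Rightarrow> bool" where
  "totally_geodesic M nab S N \<longleftrightarrow>
     (\<forall>p\<in>pts S. \<forall>\<xi>\<in>tangent_space S p. shape_operator M nab S N p \<xi> = 0)"

text \<open>The determinant of an endomorphism of the tangent space at \<open>p\<close>, computed in the coordinate basis
  of some chart around \<open>p\<close>; it does not depend on the basis.\<close>

definition endo_det :: "('m, real^'n) mfd \<Rightarrow> 'm \<Rightarrow>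
    (('m, real^'n) tvec \<Rightarrow> ('m, real^'n) tvec) \<Rightarrow> real" where
  "endo_det S p L = (let s = (SOME s. s \<in> charts_at S p)
     in det (matrix (\<lambda>w. L (coord_vec S s w p) s)))"

definition PA_hypersurface :: "('m, 'e::euclidean_space) mfd \<Rightarrow> ('m, 'e) metric \<Rightarrow>
    ('m, 'f::euclidean_space) mfd \<Rightarrow> ('m \<Rightarrow> ('m, 'e) tvec) \<Rightarrow>
    ('m \<Rightarrow> ('m, 'e) tvec) \<Rightarrow> ('m \<Rightarrow> real) \<Rightarrow> bool" where
  "PA_hypersurface M g S N V \<theta> \<longleftrightarrow>
     hypersurface M S \<and> unit_normal M g S N \<and>
     smooth_vf_along M S V \<and> (\<forall>p\<in>pts S. g p (V p) (V p) = 1) \<and>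
     smooth_fun S (pts S) \<theta> \<and> \<theta> ` pts S \<subseteq> {0..pi/2} \<and>
     (\<forall>p\<in>pts S. g p (V p) (N p) = cos (\<theta> p))"

definition tangential_component :: "('m, 'e::euclidean_space) mfd \<Rightarrow>
    ('m, 'f::euclidean_space) mfd \<Rightarrow> ('m \<Rightarrow> ('m, 'e) tvec) \<Rightarrow>
    ('m \<Rightarrow> ('m, 'e) tvec) \<Rightarrow> ('m \<Rightarrow> real) \<Rightarrow> 'm \<Rightarrow> ('m, 'f) tvec" where
  "tangential_component M S N V \<theta> p =
     (THE \<xi>. \<xi> \<in> tangent_space S p \<and> V p = incl S M p \<xi> + cos (\<theta> p) \<odot> N p)"

section \<open>Curves\<close>

definition integral_curve :: "('m, 'f::euclidean_space) mfd \<Rightarrow> ('m \<Rightarrow> ('m, 'f) tvec) \<Rightarrow>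
    real set \<Rightarrow> (real \<Rightarrow> 'm) \<Rightarrow> bool" where
  "integral_curve S X I \<gamma> \<longleftrightarrow> open I \<and> is_interval I \<and>
     continuous_map (top_of_set I) (mtop S) \<gamma> \<and>
     (\<forall>t\<in>I. \<forall>s\<in>charts_at S (\<gamma> t).
        ((\<lambda>\<tau>. cmap s (\<gamma> \<tau>)) has_vector_derivative X (\<gamma> t) s) (at t))"

definition velocity :: "('m, 'e::euclidean_space) mfd \<Rightarrow> (real \<Rightarrow> 'm) \<Rightarrow> real \<Rightarrow> ('m, 'e) tvec" where
  "velocity M \<gamma> t = (\<lambda>c. if c \<in> charts_at M (\<gamma> t)
     then vector_derivative (\<lambda>\<tau>. cmap c (\<gamma> \<tau>)) (at t) else 0)"

text \<open>The covariant derivative along a curve, by the same formula as \<open>cov_along\<close>.\<close>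

definition cov_curve :: "('m, 'e::euclidean_space) mfd \<Rightarrow> ('m, 'e) connection \<Rightarrow>
    (real \<Rightarrow> 'm) \<Rightarrow> (real \<Rightarrow> ('m, 'e) tvec) \<Rightarrow> real \<Rightarrow> ('m, 'e) tvec" where
  "cov_curve M nab \<gamma> W t = (\<lambda>c. if c \<in> charts_at M (\<gamma> t)
     then vector_derivative (\<lambda>\<tau>. W \<tau> c) (at t) +
       nab (coord_vec M c (W t c)) (\<gamma> t) (velocity M \<gamma> t) c
     else 0)"

definition geodesic :: "('m, 'e::euclidean_space) mfd \<Rightarrow> ('m, 'e) connection \<Rightarrow>
    real set \<Rightarrow> (real \<Rightarrow> 'm) \<Rightarrow> bool" where
  "geodesic M nab I \<gamma> \<longleftrightarrow> open I \<and> is_interval I \<and>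
     continuous_map (top_of_set I) (mtop M) \<gamma> \<and>
     (\<forall>c\<in>atlas M. smooth_on {t\<in>I. \<gamma> t \<in> cdom c} (\<lambda>\<tau>. cmap c (\<gamma> \<tau>))) \<and>
     (\<forall>t\<in>I. cov_curve M nab \<gamma> (velocity M \<gamma>) t = 0)"

end

theory Submission
  imports Defs
begin

text \<open>Write \<open>k\<close> for the constant value of \<open>cos \<theta>\<close>, so that \<open>V = T + k N\<close> with \<open>T\<close> tangent to \<open>S\<close>.
  Differentiating \<open>\<langle>N, N\<rangle> = 1\<close> shows that \<open>\<nabla>\<^sub>X N\<close> is tangent to \<open>S\<close>, and differentiating
  \<open>\<langle>V, N\<rangle> = k\<close> for the parallel field \<open>V\<close> gives \<open>\<langle>V, \<nabla>\<^sub>X N\<rangle> = 0\<close>. Hence \<open>\<langle>T, \<nabla>\<^sub>X N\<rangle> = 0\<close> for every tangent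
  \<open>X\<close>, and since the second fundamental form is symmetric, \<open>\<langle>\<nabla>\<^sub>T N, X\<rangle> = 0\<close> as well. So the tangent vector
  \<open>\<nabla>\<^sub>T N\<close> vanishes, that is, \<open>A T = 0\<close> (\<open>cov_N_tangential_part\<close>). Both claims follow from this.

  First, the covariant derivative of \<open>T\<close> in its own direction is \<open>\<nabla>\<^sub>T V - k \<nabla>\<^sub>T N = 0\<close>, which is the
  geodesic equation for the integral curves of \<open>T\<close>. Second, \<open>T\<close> has no zero: at a zero the unit vectors
  \<open>V\<close> and \<open>k N\<close> agree, so \<open>k = 1\<close> because the angle is at most \<open>pi/2\<close>; but then \<open>V = N\<close> at every point,
  \<open>N\<close> is parallel and \<open>S\<close> is totally geodesic. Hence \<open>A\<close> has a nontrivial kernel and determinant \<open>0\<close>.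

  These few lines use facts of Riemannian geometry for fields that are defined only along \<open>S\<close>:
  the covariant derivative along \<open>S\<close>, given by its components in charts, is a tangent vector
  (\<open>cov_along_tangent\<close>) and obeys the product rule for the metric (\<open>metric_along\<close>); both reduce to the
  formula for the connection in a chart (\<open>nab_chart\<close>). The symmetry of the second fundamental form comes
  from the symmetry of the second derivatives of the inclusion and of the Christoffel symbols
  (\<open>cov_along_coord_field_symmetric\<close>). Parallelism is a statement about globally defined tangent fields, so
  every tangent vector has to be extended to one with a bump function (\<open>extend_tangent_vector\<close>). Finally,
  a geodesic is smooth by definition while an integral curve is only assumed to be differentiable; the
  missing regularity is obtained from the geodesic equation itself (\<open>smooth_on_quadratic_ode\<close>).\<close>

section \<open>Calculus of k times continuously differentiable maps\<close>

lemma frechet_derivative_eqI: "(f has_derivative f') (at x) \<Longrightarrow> frechet_derivative f (at x) = f'"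
  using frechet_derivative_at by metis

lemma differentiable_has_derivative:
  "f differentiable (at x) \<Longrightarrow> (f has_derivative frechet_derivative f (at x)) (at x)"
  by (simp add: frechet_derivative_works)

lemma has_derivative_basis_expansion:
  fixes f :: "'a::euclidean_space \<Rightarrow> 'b::real_normed_vector"
  assumes "(f has_derivative f') (at x)"
  shows "f' v = (\<Sum>b\<in>Basis. (v \<bullet> b) *\<^sub>R f' b)"
proof -
  interpret linear f' by (rule has_derivative_linear[OF assms])
  have "f' v = f' (\<Sum>b\<in>Basis. (v \<bullet> b) *\<^sub>R b)" by (simp add: euclidean_representation)
  then show ?thesis by (simp add: sum scale)
qed

lemma Ck_on_cong:
  assumes "open S" "\<And>x. x \<in> S \<Longrightarrow> f x = h x" "Ck_on k S f"
  shows "Ck_on k S h"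
  using assms(2,3)
proof (induction k arbitrary: f h)
  case 0
  then show ?case by (auto cong: continuous_on_cong)
next
  case (Suc k)
  have D: "(h has_derivative frechet_derivative f (at x)) (at x)" if "x \<in> S" for x
    using that Suc.prems assms(1)
    by (intro has_derivative_transform_within_open[OF differentiable_has_derivative]) auto
  have "Ck_on k S (\<lambda>x. frechet_derivative h (at x) v)" for v
  proof (rule Suc.IH)
    show "Ck_on k S (\<lambda>x. frechet_derivative f (at x) v)" using Suc.prems by simp
    show "\<And>x. x \<in> S \<Longrightarrow> frechet_derivative f (at x) v = frechet_derivative h (at x) v"
      using frechet_derivative_eqI[OF D] by simp
  qed
  then show ?case using D by (auto simp: differentiable_def)
qed

lemma Ck_on_subset: "Ck_on k S f \<Longrightarrow> T \<subseteq> S \<Longrightarrow> Ck_on k T f"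
  by (induction k arbitrary: f) (auto intro: continuous_on_subset)

lemma Ck_on_Union:
  assumes "\<And>U. U \<in> \<U> \<Longrightarrow> open U" "\<And>U. U \<in> \<U> \<Longrightarrow> Ck_on k U f"
  shows "Ck_on k (\<Union>\<U>) f"
  using assms(2)
proof (induction k arbitrary: f)
  case 0
  then show ?case using assms(1) by (auto intro: continuous_on_open_Union)
qed auto

lemma Ck_on_Un:
  "open S \<Longrightarrow> open T \<Longrightarrow> Ck_on k S f \<Longrightarrow> Ck_on k T f \<Longrightarrow> Ck_on k (S \<union> T) f"
  using Ck_on_Union[of "{S, T}" k f] by auto

lemma Ck_on_SucI:
  assumes "open S" "\<And>x. x \<in> S \<Longrightarrow> (f has_derivative f' x) (at x)" "\<And>v. Ck_on k S (\<lambda>x. f' x v)"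
  shows "Ck_on (Suc k) S f"
proof -
  have "Ck_on k S (\<lambda>x. frechet_derivative f (at x) v)" for v
    by (rule Ck_on_cong[OF assms(1) _ assms(3)[of v]])
      (simp add: frechet_derivative_eqI[OF assms(2)])
  then show ?thesis using assms(2) by (auto simp: differentiable_def)
qed

lemma Ck_on_SucD:
  assumes "Ck_on (Suc k) S f"
  shows "\<And>x. x \<in> S \<Longrightarrow> (f has_derivative frechet_derivative f (at x)) (at x)"
    "Ck_on k S (\<lambda>x. frechet_derivative f (at x) v)"
  using assms differentiable_has_derivative by auto

lemma Ck_on_pred: "Ck_on (Suc k) S f \<Longrightarrow> Ck_on k S f"
proof (induction k arbitrary: f)
  case 0
  then show ?case
    by (auto intro!: continuous_at_imp_continuous_on differentiable_imp_continuous_within)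
next
  case (Suc k)
  then show ?case by (metis Ck_on.simps(2))
qed

lemma Ck_on_const [simp]: "Ck_on k S (\<lambda>x. c)"
  by (induction k arbitrary: c) auto

lemma Ck_on_linear:
  assumes "open S" "bounded_linear L" shows "Ck_on k S L"
proof (cases k)
  case 0
  then show ?thesis using assms by (simp add: linear_continuous_on)
next
  case (Suc n)
  show ?thesis unfolding Suc
    by (rule Ck_on_SucI[where f' = "\<lambda>x. L"])
      (use assms in \<open>auto intro: bounded_linear_imp_has_derivative\<close>)
qed

lemma Ck_on_add:
  assumes "open S" "Ck_on k S f" "Ck_on k S h"
  shows "Ck_on k S (\<lambda>x. f x + h x)"
  using assms(2,3)
proof (induction k arbitrary: f h)
  case 0
  then show ?case by (auto intro: continuous_on_add)
next
  case (Suc k)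
  show ?case
    by (rule Ck_on_SucI[OF assms(1) has_derivative_add[OF Ck_on_SucD(1) Ck_on_SucD(1)]])
      (use Suc in auto)
qed

lemma Ck_on_sum:
  assumes "open S" "\<And>i. i \<in> A \<Longrightarrow> Ck_on k S (f i)"
  shows "Ck_on k S (\<lambda>x. \<Sum>i\<in>A. f i x)"
  using assms(2) by (induction A rule: infinite_finite_induct) (auto intro: Ck_on_add assms(1))

lemma Ck_on_scaleR:
  assumes "open S" "Ck_on k S f" "Ck_on k S h"
  shows "Ck_on k S (\<lambda>x. f x *\<^sub>R h x)"
  using assms(2,3)
proof (induction k arbitrary: f h)
  case 0
  then show ?case by (auto intro: continuous_on_scaleR)
next
  case (Suc k)
  show ?case
    by (rule Ck_on_SucI[OF assms(1) has_derivative_scaleR[OF Ck_on_SucD(1) Ck_on_SucD(1)]])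
      (rule Suc.prems, assumption, rule Suc.prems, assumption,
        intro Ck_on_add Suc.IH assms(1) Ck_on_SucD(2)[OF Suc.prems(1)] Ck_on_SucD(2)[OF Suc.prems(2)]
        Suc.prems[THEN Ck_on_pred])
qed

lemma Ck_on_bounded_linear:
  assumes "open S" "bounded_linear L" "Ck_on k S f"
  shows "Ck_on k S (\<lambda>x. L (f x))"
  using assms(3)
proof (induction k arbitrary: f)
  case 0
  then show ?case using bounded_linear.continuous_on[OF assms(2)] by auto
next
  case (Suc k)
  show ?case
    by (rule Ck_on_SucI[OF assms(1) bounded_linear.has_derivative[OF assms(2) Ck_on_SucD(1)]])
      (use Suc in auto)
qed

text \<open>Expanding the outer derivative in a basis turns the chain rule into a sum of products of maps to which
  the induction hypothesis applies.\<close>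

lemma Ck_on_compose:
  fixes f :: "'b::euclidean_space \<Rightarrow> 'c::real_normed_vector" and h :: "'a::euclidean_space \<Rightarrow> 'b"
  assumes "open S" "Ck_on k T f" "Ck_on k S h" "h ` S \<subseteq> T"
  shows "Ck_on k S (\<lambda>x. f (h x))"
  using assms(2,3)
proof (induction k arbitrary: f)
  case 0
  then show ?case using assms(4) by (auto intro: continuous_on_compose2)
next
  case (Suc k)
  let ?f' = "\<lambda>y. frechet_derivative f (at y)" and ?h' = "\<lambda>x. frechet_derivative h (at x)"
  have 1: "((\<lambda>x. f (h x)) has_derivative (\<lambda>v. \<Sum>b\<in>Basis. (?h' x v \<bullet> b) *\<^sub>R ?f' (h x) b)) (at x)"
    if "x \<in> S" for x
  proof -
    have "((\<lambda>x. f (h x)) has_derivative (\<lambda>v. ?f' (h x) (?h' x v))) (at x)"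
      by (rule has_derivative_compose[OF Ck_on_SucD(1)[OF Suc.prems(2) that]
            Ck_on_SucD(1)[OF Suc.prems(1)]]) (use that assms(4) in auto)
    moreover have "?f' (h x) (?h' x v) = (\<Sum>b\<in>Basis. (?h' x v \<bullet> b) *\<^sub>R ?f' (h x) b)" for v
      by (rule has_derivative_basis_expansion[OF Ck_on_SucD(1)[OF Suc.prems(1)]])
        (use that assms(4) in auto)
    ultimately show ?thesis by (simp only:)
  qed
  show ?case
    by (rule Ck_on_SucI[OF assms(1) 1])
      (assumption, intro Ck_on_sum Ck_on_scaleR assms(1) Suc.IH Ck_on_SucD(2)[OF Suc.prems(1)]
        Ck_on_SucD(2)[OF Suc.prems(2)] Suc.prems(2)[THEN Ck_on_pred]
        Ck_on_bounded_linear[OF _ bounded_linear_inner_left])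
qed

lemma smooth_on_Ck: "smooth_on S f \<Longrightarrow> Ck_on k S f"
  by (simp add: smooth_on_def)

lemma smooth_on_has_derivative:
  "smooth_on S f \<Longrightarrow> x \<in> S \<Longrightarrow> (f has_derivative frechet_derivative f (at x)) (at x)"
  using Ck_on_SucD(1)[OF smooth_on_Ck[of S f "Suc 0"]] by auto

lemma smooth_on_frechet_derivative:
  "smooth_on S f \<Longrightarrow> smooth_on S (\<lambda>x. frechet_derivative f (at x) v)"
  by (auto simp: smooth_on_def intro: Ck_on_SucD)

lemma smooth_on_cong:
  "open S \<Longrightarrow> (\<And>x. x \<in> S \<Longrightarrow> f x = h x) \<Longrightarrow> smooth_on S f \<Longrightarrow> smooth_on S h"
  unfolding smooth_on_def using Ck_on_cong by metis

lemma smooth_on_subset: "smooth_on S f \<Longrightarrow> T \<subseteq> S \<Longrightarrow> smooth_on T f"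
  unfolding smooth_on_def using Ck_on_subset by metis

lemma smooth_on_compose:
  fixes f :: "'b::euclidean_space \<Rightarrow> 'c::real_normed_vector" and h :: "'a::euclidean_space \<Rightarrow> 'b"
  shows "open S \<Longrightarrow> smooth_on T f \<Longrightarrow> smooth_on S h \<Longrightarrow> h ` S \<subseteq> T \<Longrightarrow> smooth_on S (\<lambda>x. f (h x))"
  unfolding smooth_on_def using Ck_on_compose by metis

lemma smooth_on_scaleR:
  "open S \<Longrightarrow> smooth_on S f \<Longrightarrow> smooth_on S h \<Longrightarrow> smooth_on S (\<lambda>x. f x *\<^sub>R h x)"
  unfolding smooth_on_def using Ck_on_scaleR by metis

lemma smooth_on_inner_left:
  "open S \<Longrightarrow> smooth_on S f \<Longrightarrow> smooth_on S (\<lambda>x. f x \<bullet> v)"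
  unfolding smooth_on_def using Ck_on_bounded_linear[OF _ bounded_linear_inner_left] by metis

section \<open>Symmetry of second derivatives\<close>

text \<open>The mean value theorem, applied once in each direction. The second difference is symmetric in \<open>v\<close> and
  \<open>w\<close> whereas the iterated derivative is not visibly so; comparing the two versions of this formula
  is what proves the symmetry of second derivatives.\<close>

lemma second_difference_mean_value:
  fixes f :: "'a::euclidean_space \<Rightarrow> real"
  assumes f: "Ck_on 2 (ball x r) f" and h: "0 < h" "h * (norm v + norm w) < r"
  shows "\<exists>y\<in>ball x r. dist x y \<le> h * (norm v + norm w) \<and>
    f (x + h *\<^sub>R v + h *\<^sub>R w) - f (x + h *\<^sub>R v) - f (x + h *\<^sub>R w) + f x =
      h * h * frechet_derivative (\<lambda>y. frechet_derivative f (at y) v) (at y) w"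
proof -
  let ?D = "\<lambda>y. frechet_derivative f (at y) v"
  let ?DD = "\<lambda>y. frechet_derivative ?D (at y) w"
  have near: "dist x (x + s *\<^sub>R v + t *\<^sub>R w) \<le> h * (norm v + norm w)"
    if "0 \<le> s" "s \<le> h" "0 \<le> t" "t \<le> h" for s t
  proof -
    have "norm (s *\<^sub>R v + t *\<^sub>R w) \<le> s * norm v + t * norm w"
      using that by (intro order_trans[OF norm_triangle_ineq]) auto
    also have "\<dots> \<le> h * norm v + h * norm w"
      using that by (intro add_mono mult_right_mono) auto
    finally show ?thesis
      by (simp add: dist_norm algebra_simps) (metis minus_add_distrib norm_minus_cancel add.commute uminus_add_conv_diff)
  qed
  have in_ball: "x + s *\<^sub>R v + t *\<^sub>R w \<in> ball x r"
    if "0 \<le> s" "s \<le> h" "0 \<le> t" "t \<le> h" for s t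
    using near[OF that] h(2) by simp
  have f1: "Ck_on (Suc 0) (ball x r) f"
    using f unfolding numeral_2_eq_2 by (rule Ck_on_pred)
  have f2: "Ck_on (Suc 0) (ball x r) ?D"
    using f unfolding numeral_2_eq_2 by (rule Ck_on_SucD(2))
  have line: "((\<lambda>s. q (a + s *\<^sub>R u)) has_real_derivative
      frechet_derivative q (at (a + s *\<^sub>R u)) u) (at s)"
    if "Ck_on (Suc 0) (ball x r) q" "a + s *\<^sub>R u \<in> ball x r" for q :: "'a \<Rightarrow> real" and a u s
  proof -
    let ?q' = "frechet_derivative q (at (a + s *\<^sub>R u))"
    note q' = Ck_on_SucD(1)[OF that]
    have "((\<lambda>s. q (a + s *\<^sub>R u)) has_derivative (\<lambda>t. ?q' (t *\<^sub>R u))) (at s)"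
      by (rule has_derivative_compose[of "\<lambda>s. a + s *\<^sub>R u" _ s UNIV q, OF _ q'])
        (auto intro!: derivative_eq_intros)
    moreover have "(\<lambda>t. ?q' (t *\<^sub>R u)) = (*) (?q' u)"
      using has_derivative_linear[OF q'] by (auto simp: linear_scale)
    ultimately show ?thesis by (simp add: has_field_derivative_def)
  qed
  have comm: "x + s *\<^sub>R v + h *\<^sub>R w = x + h *\<^sub>R w + s *\<^sub>R v" for s by (simp add: algebra_simps)
  have "\<exists>s. 0 < s \<and> s < h \<and>
     (f (x + h *\<^sub>R w + h *\<^sub>R v) - f (x + h *\<^sub>R v)) - (f (x + h *\<^sub>R w + 0 *\<^sub>R v) - f (x + 0 *\<^sub>R v)) =
     (h - 0) * (?D (x + h *\<^sub>R w + s *\<^sub>R v) - ?D (x + s *\<^sub>R v))"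
    by (rule MVT2[OF h(1)], rule DERIV_diff)
      (use h(1) in \<open>auto intro!: line[OF f1]
         in_ball[where t = h, unfolded comm] in_ball[where t = 0, simplified]\<close>)
  then obtain s where s: "0 < s" "s < h" and
    1: "f (x + h *\<^sub>R v + h *\<^sub>R w) - f (x + h *\<^sub>R v) - f (x + h *\<^sub>R w) + f x =
      h * (?D (x + s *\<^sub>R v + h *\<^sub>R w) - ?D (x + s *\<^sub>R v))"
    by (auto simp: algebra_simps)
  have "\<exists>t. 0 < t \<and> t < h \<and>
     ?D (x + s *\<^sub>R v + h *\<^sub>R w) - ?D (x + s *\<^sub>R v + 0 *\<^sub>R w) = (h - 0) * ?DD (x + s *\<^sub>R v + t *\<^sub>R w)"
    by (rule MVT2[OF h(1)]) (use s in \<open>auto intro!: line[OF f2] in_ball\<close>)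
  then obtain t where t: "0 < t" "t < h" and
    2: "?D (x + s *\<^sub>R v + h *\<^sub>R w) - ?D (x + s *\<^sub>R v) = h * ?DD (x + s *\<^sub>R v + t *\<^sub>R w)"
    by auto
  show ?thesis
  proof (intro bexI conjI)
    show "dist x (x + s *\<^sub>R v + t *\<^sub>R w) \<le> h * (norm v + norm w)" using near s t by simp
    show "x + s *\<^sub>R v + t *\<^sub>R w \<in> ball x r" using in_ball s t by simp
  qed (simp only: 1 2 mult.assoc)
qed

lemma symmetric_second_derivative_real:
  fixes f :: "'a::euclidean_space \<Rightarrow> real"
  assumes S: "open S" "x \<in> S" and f: "Ck_on 2 S f"
  shows "frechet_derivative (\<lambda>y. frechet_derivative f (at y) v) (at x) w =
         frechet_derivative (\<lambda>y. frechet_derivative f (at y) w) (at x) v" (is "?F x = ?G x")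
proof (rule ccontr)
  assume ne: "?F x \<noteq> ?G x"
  define e where "e = \<bar>?F x - ?G x\<bar> / 2"
  have e: "e > 0" using ne by (simp add: e_def)
  have "continuous_on S ?F" "continuous_on S ?G"
    using f unfolding numeral_2_eq_2 by (simp_all only: Ck_on.simps)
  then have "isCont ?F x" "isCont ?G x" using S continuous_on_eq_continuous_at by blast+
  then obtain r1 r2 where r1: "r1 > 0" "\<And>y. dist y x < r1 \<Longrightarrow> dist (?F y) (?F x) < e"
    and r2: "r2 > 0" "\<And>y. dist y x < r2 \<Longrightarrow> dist (?G y) (?G x) < e"
    using e unfolding continuous_at_eps_delta by metis
  obtain r0 where r0: "r0 > 0" "ball x r0 \<subseteq> S" using S openE by blast
  define r where "r = min r0 (min r1 r2)"
  have r: "r > 0" "r \<le> r1" "r \<le> r2" "ball x r \<subseteq> S" using r0 r1 r2 by (auto simp: r_def)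
  have fr: "Ck_on 2 (ball x r) f" using f r(4) by (rule Ck_on_subset)
  \<comment> \<open>small enough for the second difference with step \<open>h\<close> to stay inside the ball of radius \<open>r\<close>\<close>
  define h where "h = r / (2 * (norm v + norm w + 1))"
  have pos: "norm v + norm w + 1 > 0" by (smt (verit) norm_ge_zero)
  have "h * (norm v + norm w + 1) = r / 2" using pos by (simp add: h_def field_simps)
  moreover have hp: "h > 0" using r pos by (simp add: h_def)
  ultimately have h: "h * (norm v + norm w) < r" "h * (norm w + norm v) < r"
    using r(1) by (simp_all add: algebra_simps)
  obtain y where y: "y \<in> ball x r" and 1:
    "f (x + h *\<^sub>R v + h *\<^sub>R w) - f (x + h *\<^sub>R v) - f (x + h *\<^sub>R w) + f x = h * h * ?F y"
    using second_difference_mean_value[OF fr hp h(1)] by blast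
  obtain z where z: "z \<in> ball x r" and 2:
    "f (x + h *\<^sub>R w + h *\<^sub>R v) - f (x + h *\<^sub>R w) - f (x + h *\<^sub>R v) + f x = h * h * ?G z"
    using second_difference_mean_value[OF fr hp h(2)] by blast
  have "h * h * ?F y = h * h * ?G z" using 1 2 by (simp add: algebra_simps)
  then have "?F y = ?G z" using hp by simp
  moreover have "dist y x < r1" "dist z x < r2"
    using y z r by (auto simp: dist_commute)
  then have "dist (?F y) (?F x) < e" "dist (?G z) (?G x) < e" using r1 r2 by blast+
  \<comment> \<open>\<open>?F x\<close> and \<open>?G x\<close> are \<open>2 * e\<close> apart, yet the common value is closer than \<open>e\<close> to both\<close>
  ultimately show False unfolding e_def dist_real_def by argo
qed

lemma symmetric_second_derivative:
  fixes f :: "'a::euclidean_space \<Rightarrow> 'b::euclidean_space"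
  assumes S: "open S" "x \<in> S" and f: "smooth_on S f"
  shows "frechet_derivative (\<lambda>y. frechet_derivative f (at y) v) (at x) w =
         frechet_derivative (\<lambda>y. frechet_derivative f (at y) w) (at x) v"
proof (rule euclidean_eqI)
  fix b :: 'b assume "b \<in> Basis"
  have D1: "frechet_derivative (\<lambda>y. f y \<bullet> b) (at y) u = frechet_derivative f (at y) u \<bullet> b"
    if "y \<in> S" for y u
    by (subst frechet_derivative_eqI[OF has_derivative_inner_left[OF smooth_on_has_derivative[OF f that]]]) simp
  have D2: "frechet_derivative (\<lambda>y. frechet_derivative (\<lambda>y. f y \<bullet> b) (at y) u) (at x) u' =
      frechet_derivative (\<lambda>y. frechet_derivative f (at y) u) (at x) u' \<bullet> b" for u u'
  proof -
    have "((\<lambda>y. frechet_derivative f (at y) u \<bullet> b) has_derivative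
        (\<lambda>u'. frechet_derivative (\<lambda>y. frechet_derivative f (at y) u) (at x) u' \<bullet> b)) (at x)"
      by (rule has_derivative_inner_left[OF smooth_on_has_derivative[OF smooth_on_frechet_derivative[OF f] S(2)]])
    from has_derivative_transform_within_open[OF this S] D1
    show ?thesis by (intro fun_cong[OF frechet_derivative_eqI]) auto
  qed
  show "frechet_derivative (\<lambda>y. frechet_derivative f (at y) v) (at x) w \<bullet> b =
         frechet_derivative (\<lambda>y. frechet_derivative f (at y) w) (at x) v \<bullet> b"
    using symmetric_second_derivative_real[OF S smooth_on_Ck[OF smooth_on_inner_left[OF S(1) f]],
        of b v w] unfolding D2 .
qed

section \<open>A smooth bump function\<close>

text \<open>The functions \<open>exp (-1/t) / t^n\<close>, extended by \<open>0\<close>. The span of the whole family is closed under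
  differentiation, so the smoothness of all its members is proved by one induction.\<close>

definition flat :: "nat \<Rightarrow> real \<Rightarrow> real" where
  "flat n t = (if t > 0 then inverse t ^ n * exp (- inverse t) else 0)"

lemma flat_tendsto_0: "(flat n \<longlongrightarrow> 0) (at 0)"
proof -
  have "((\<lambda>y::real. y ^ n / exp y) \<longlongrightarrow> 0) at_top" by (rule tendsto_power_div_exp_0)
  then have "((\<lambda>t::real. inverse t ^ n / exp (inverse t)) \<longlongrightarrow> 0) (at_right 0)"
    using filterlim_compose filterlim_inverse_at_top_right by blast
  then have "(flat n \<longlongrightarrow> 0) (at_right 0)"
    by (rule Lim_transform_eventually)
      (auto simp: flat_def exp_minus field_simps eventually_at intro!: exI[of _ 1])
  moreover have "(flat n \<longlongrightarrow> 0) (at_left 0)"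
    by (rule Lim_transform_eventually[OF tendsto_const])
      (auto simp: flat_def eventually_at intro!: exI[of _ 1])
  ultimately show ?thesis by (simp add: filterlim_split_at)
qed

lemma flat_has_derivative:
  "(flat n has_real_derivative flat (n + 2) t - n * flat (n + 1) t) (at t)"
proof -
  consider "t > 0" | "t < 0" | "t = 0" by linarith
  then show ?thesis
  proof cases
    case 1
    have "((\<lambda>t. inverse t ^ n) has_real_derivative - (n * inverse t ^ (n + 1))) (at t)"
      by (rule DERIV_cong[OF DERIV_power[OF DERIV_inverse]]) (use 1 in \<open>cases n; simp\<close>)+
    moreover have "((\<lambda>t. exp (- inverse t)) has_real_derivative
        exp (- inverse t) * inverse t ^ 2) (at t)"
      using 1 by (auto intro!: derivative_eq_intros simp: power2_eq_square)
    ultimately have "((\<lambda>t. inverse t ^ n * exp (- inverse t)) has_real_derivative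
        flat (n + 2) t - n * flat (n + 1) t) (at t)"
      by (rule DERIV_cong[OF DERIV_mult])
        (use 1 in \<open>simp add: flat_def power_add power2_eq_square algebra_simps\<close>)
    then show ?thesis
      by (rule has_field_derivative_transform_within_open[of _ _ _ "{0<..}"])
        (use 1 in \<open>auto simp: flat_def\<close>)
  next
    case 2
    have "((\<lambda>t. 0) has_real_derivative flat (n + 2) t - n * flat (n + 1) t) (at t)"
      using 2 by (simp add: flat_def)
    then show ?thesis
      by (rule has_field_derivative_transform_within_open[of _ _ _ "{..<0}"])
        (use 2 in \<open>auto simp: flat_def\<close>)
  next
    case 3
    have "(\<lambda>h. (flat n (0 + h) - flat n 0) / h) = flat (n + 1)"
      by (auto simp: flat_def fun_eq_iff field_simps)
    then show ?thesis using flat_tendsto_0[of "n + 1"] 3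
      by (simp add: DERIV_def) (simp add: flat_def)
  qed
qed

lemma Ck_on_flat: "Ck_on k UNIV (flat n)"
proof (induction k arbitrary: n)
  case 0
  then show ?case using flat_has_derivative DERIV_isCont continuous_at_imp_continuous_on
    by (metis Ck_on.simps(1))
next
  case (Suc k)
  have "Ck_on k UNIV (\<lambda>t. (v *\<^sub>R flat (n + 2) t) + (- v * n) *\<^sub>R flat (n + 1) t)" for v :: real
    by (intro Ck_on_add Ck_on_scaleR Suc Ck_on_const open_UNIV)
  then have "Ck_on k UNIV (\<lambda>t. (flat (n + 2) t - n * flat (n + 1) t) * v)" for v
    by (simp add: algebra_simps)
  then show ?case
    by (rule Ck_on_SucI[OF open_UNIV flat_has_derivative[unfolded has_field_derivative_def]])
qed

text \<open>The function \<open>exp (-1/t)\<close>, normalised, at \<open>t = r\<^sup>2 - (dist a x)\<^sup>2\<close>.\<close>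

lemma smooth_bump:
  fixes a :: "'a::euclidean_space"
  assumes "r > 0"
  obtains \<beta> :: "'a \<Rightarrow> real" where "smooth_on UNIV \<beta>" "\<beta> a = 1" "\<And>x. dist a x \<ge> r \<Longrightarrow> \<beta> x = 0"
proof
  let ?q = "\<lambda>x. r\<^sup>2 + - (\<Sum>b\<in>Basis. (((x - a) \<bullet> b) *\<^sub>R ((x - a) \<bullet> b)))"
  have q: "?q x = r\<^sup>2 - (dist a x)\<^sup>2" for x
    by (simp add: dist_norm norm_minus_commute[of a] power2_norm_eq_inner
        euclidean_inner[of "x - a" "x - a"])
  let ?b = "\<lambda>x. (1 / flat 0 (r\<^sup>2)) *\<^sub>R flat 0 (?q x)"
  have lin: "Ck_on k UNIV (\<lambda>x. (x - a) \<bullet> b)" for k and b :: 'a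
  proof -
    have "Ck_on k UNIV (\<lambda>x. x \<bullet> b + - (a \<bullet> b))"
      by (intro Ck_on_add Ck_on_const Ck_on_linear open_UNIV bounded_linear_inner_left)
    then show ?thesis by (simp add: inner_diff_left)
  qed
  have "Ck_on k UNIV ?q" for k
    by (intro Ck_on_add Ck_on_const open_UNIV Ck_on_bounded_linear[OF _ bounded_linear_minus[OF bounded_linear_ident]]
        Ck_on_sum Ck_on_scaleR lin)
  then show "smooth_on UNIV ?b" unfolding smooth_on_def
    by (intro allI Ck_on_scaleR Ck_on_const open_UNIV Ck_on_compose[OF _ Ck_on_flat]) auto
  show "?b a = 1" using assms by (simp add: q flat_def)
  show "?b x = 0" if "dist a x \<ge> r" for x
    unfolding q using that assms by (simp add: flat_def not_less power_mono)
qed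

section \<open>Tangent vectors in charts\<close>

lemma charts_at_iff [simp]: "c \<in> charts_at M p \<longleftrightarrow> c \<in> atlas M \<and> p \<in> cdom c"
  by (simp add: charts_at_def)

lemma chart_openin: "smooth_manifold M \<Longrightarrow> c \<in> atlas M \<Longrightarrow> openin (mtop M) (cdom c)"
  by (simp add: smooth_manifold_def)

lemma chart_pts: "smooth_manifold M \<Longrightarrow> c \<in> atlas M \<Longrightarrow> p \<in> cdom c \<Longrightarrow> p \<in> pts M"
  using chart_openin openin_subset by blast

lemma chart_exists:
  assumes "smooth_manifold M" "p \<in> pts M" obtains c where "c \<in> atlas M" "p \<in> cdom c"
proof -
  have "p \<in> (\<Union>c\<in>atlas M. cdom c)" using assms by (simp add: smooth_manifold_def)
  then show ?thesis using that by blast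
qed

lemma chart_homeomorphic:
  "smooth_manifold M \<Longrightarrow> c \<in> atlas M \<Longrightarrow>
     homeomorphic_map (subtopology (mtop M) (cdom c)) (top_of_set (cmap c ` cdom c)) (cmap c)"
  by (simp add: smooth_manifold_def)

lemma chart_cinv [simp]:
  assumes "smooth_manifold M" "c \<in> atlas M" "p \<in> cdom c"
  shows "cinv c (cmap c p) = p"
proof -
  have "inj_on (cmap c) (cdom c)"
    using chart_homeomorphic[OF assms(1,2)] chart_openin[OF assms(1,2), THEN openin_subset]
    by (metis homeomorphic_imp_injective_map topspace_subtopology_subset)
  then show ?thesis using assms(3) by simp
qed

lemma chart_image_open:
  assumes "smooth_manifold M" "c \<in> atlas M" "openin (mtop M) U"
  shows "open (cmap c ` (U \<inter> cdom c))"
proof -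
  have "openin (subtopology (mtop M) (cdom c)) (U \<inter> cdom c)"
    using assms(3) by (rule openin_subtopology_Int)
  then have "openin (top_of_set (cmap c ` cdom c)) (cmap c ` (U \<inter> cdom c))"
    using homeomorphic_imp_open_map[OF chart_homeomorphic[OF assms(1,2)]]
    by (simp add: open_map_def)
  moreover have "open (cmap c ` cdom c)" using assms by (simp add: smooth_manifold_def)
  ultimately show ?thesis using openin_open_eq by blast
qed

lemma transition_smooth:
  "smooth_manifold M \<Longrightarrow> c \<in> atlas M \<Longrightarrow> d \<in> atlas M \<Longrightarrow>
     smooth_on (cmap c ` (cdom c \<inter> cdom d)) (cmap d \<circ> cinv c)"
  by (simp add: smooth_manifold_def)

lemma chart_overlap_open:
  "smooth_manifold M \<Longrightarrow> c \<in> atlas M \<Longrightarrow> d \<in> atlas M \<Longrightarrow> open (cmap c ` (cdom c \<inter> cdom d))"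
  using chart_image_open chart_openin by (metis Int_commute)

abbreviation jac :: "('m, 'e::euclidean_space) chart \<Rightarrow> ('m, 'e) chart \<Rightarrow> 'm \<Rightarrow> 'e \<Rightarrow> 'e" where
  "jac c d p \<equiv> frechet_derivative (cmap d \<circ> cinv c) (at (cmap c p))"

lemma jac_has_derivative:
  assumes "smooth_manifold M" "c \<in> charts_at M p" "d \<in> charts_at M p"
  shows "(cmap d \<circ> cinv c has_derivative jac c d p) (at (cmap c p))"
  by (rule smooth_on_has_derivative[OF transition_smooth[OF assms(1)]]) (use assms in auto)

lemma chart_change_derivative:
  assumes M: "smooth_manifold M" and c: "c \<in> charts_at M p" and d: "d \<in> charts_at M p"
    and h: "(h \<circ> cinv d has_derivative h') (at (cmap d p))"
  shows "(h \<circ> cinv c has_derivative (\<lambda>w. h' (jac c d p w))) (at (cmap c p))"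
proof -
  have "((h \<circ> cinv d) \<circ> (cmap d \<circ> cinv c) has_derivative h' \<circ> jac c d p) (at (cmap c p))"
    by (rule diff_chain_at[OF jac_has_derivative[OF M c d]]) (use M c d h in simp)
  then have "((h \<circ> cinv d) \<circ> (cmap d \<circ> cinv c) has_derivative (\<lambda>w. h' (jac c d p w))) (at (cmap c p))"
    by (simp add: o_def)
  then show ?thesis
    by (rule has_derivative_transform_within_open[OF _ chart_overlap_open[OF M, of c d]])
      (use M c d in auto)
qed

lemma jac_jac:
  assumes "smooth_manifold M" "c \<in> charts_at M p" "d \<in> charts_at M p" "e \<in> charts_at M p"
  shows "jac d e p (jac c d p w) = jac c e p w"
proof -
  have "jac c e p = (\<lambda>w. jac d e p (jac c d p w))"
    by (rule frechet_derivative_eqI[OF chart_change_derivative[OF assms(1-3)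
        jac_has_derivative[OF assms(1,3,4)]]])
  then show ?thesis by (rule fun_cong[symmetric])
qed

lemma jac_self:
  assumes "smooth_manifold M" "c \<in> charts_at M p"
  shows "jac c c p w = w"
proof -
  have "((\<lambda>x. x) has_derivative (\<lambda>w. w)) (at (cmap c p))" by (rule has_derivative_ident)
  then have "(cmap c \<circ> cinv c has_derivative (\<lambda>w. w)) (at (cmap c p))"
    by (rule has_derivative_transform_within_open[OF _ chart_overlap_open[OF assms(1), of c c]])
      (use assms in auto)
  then show ?thesis by (simp add: frechet_derivative_eqI)
qed

lemma jac_linear:
  assumes "smooth_manifold M" "c \<in> charts_at M p" "d \<in> charts_at M p"
  shows "linear (jac c d p)"
  using jac_has_derivative[OF assms] by (rule has_derivative_linear)

lemma tangent_spaceD: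
  "v \<in> tangent_space M p \<Longrightarrow> c \<in> charts_at M p \<Longrightarrow> d \<in> charts_at M p \<Longrightarrow> v d = jac c d p (v c)"
  "v \<in> tangent_space M p \<Longrightarrow> c \<notin> charts_at M p \<Longrightarrow> v c = 0"
  unfolding tangent_space_def by blast+

lemma tangent_spaceI:
  assumes "\<And>c d. c \<in> charts_at M p \<Longrightarrow> d \<in> charts_at M p \<Longrightarrow> v d = jac c d p (v c)"
    and "\<And>c. c \<notin> charts_at M p \<Longrightarrow> v c = 0"
  shows "v \<in> tangent_space M p"
  unfolding tangent_space_def using assms by blast

lemma tangent_space_eqI:
  assumes "v \<in> tangent_space M p" "w \<in> tangent_space M p" "c \<in> charts_at M p" "v c = w c"
  shows "v = w"
proof
  fix d
  show "v d = w d"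
  proof (cases "d \<in> charts_at M p")
    case True
    then show ?thesis using tangent_spaceD(1)[OF assms(1,3)] tangent_spaceD(1)[OF assms(2,3)] assms(4)
      by metis
  next
    case False
    then show ?thesis using tangent_spaceD(2)[OF assms(1)] tangent_spaceD(2)[OF assms(2)] by metis
  qed
qed

lemma coord_vec_tangent:
  assumes "smooth_manifold M" "c \<in> charts_at M p"
  shows "coord_vec M c w p \<in> tangent_space M p"
  by (rule tangent_spaceI) (simp_all add: coord_vec_def jac_jac[OF assms] del: charts_at_iff)

lemma coord_vec_chart:
  assumes "smooth_manifold M" "c \<in> charts_at M p"
  shows "coord_vec M c w p c = w"
  using jac_self[OF assms] assms(2) by (simp add: coord_vec_def)

lemma tangent_eq_coord_vec:
  assumes "smooth_manifold M" "c \<in> charts_at M p" "v \<in> tangent_space M p"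
  shows "v = coord_vec M c (v c) p"
  by (rule tangent_space_eqI[OF assms(3) coord_vec_tangent[OF assms(1,2)] assms(2)])
    (simp add: coord_vec_chart[OF assms(1,2)])

lemma tangent_space_0: "smooth_manifold M \<Longrightarrow> 0 \<in> tangent_space M p"
  by (rule tangent_spaceI) (simp_all only: zero_fun_apply linear_0[OF jac_linear])

lemma tangent_space_add:
  assumes "smooth_manifold M" "v \<in> tangent_space M p" "w \<in> tangent_space M p"
  shows "v + w \<in> tangent_space M p"
proof (rule tangent_spaceI)
  fix c d assume cd: "c \<in> charts_at M p" "d \<in> charts_at M p"
  show "(v + w) d = jac c d p ((v + w) c)"
    using tangent_spaceD(1)[OF assms(2) cd] tangent_spaceD(1)[OF assms(3) cd]
    by (simp only: plus_fun_apply linear_add[OF jac_linear[OF assms(1) cd]])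
next
  fix c assume "c \<notin> charts_at M p"
  with assms(2,3) tangent_spaceD(2) show "(v + w) c = 0" by (metis add_0 plus_fun_apply)
qed

lemma tangent_space_scale:
  assumes "smooth_manifold M" "v \<in> tangent_space M p"
  shows "r \<odot> v \<in> tangent_space M p"
proof (rule tangent_spaceI)
  fix c d assume cd: "c \<in> charts_at M p" "d \<in> charts_at M p"
  show "(r \<odot> v) d = jac c d p ((r \<odot> v) c)"
    using tangent_spaceD(1)[OF assms(2) cd]
    by (simp only: tscale_def linear_scale[OF jac_linear[OF assms(1) cd]])
next
  fix c assume "c \<notin> charts_at M p"
  with assms(2) tangent_spaceD(2) show "(r \<odot> v) c = 0" by (metis tscale_def scaleR_zero_right)
qed

lemma tscale_apply [simp]: "(r \<odot> v) c = r *\<^sub>R v c"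
  by (simp add: tscale_def)

lemma tscale_minus_one: "- v = (-1) \<odot> v"
  by (simp add: fun_eq_iff)

lemma tscale_zero [simp]: "0 \<odot> v = 0"
  by (simp add: fun_eq_iff)

lemma tscale_one [simp]: "1 \<odot> v = v"
  by (simp add: fun_eq_iff)

lemma tangent_space_uminus:
  "smooth_manifold M \<Longrightarrow> v \<in> tangent_space M p \<Longrightarrow> - v \<in> tangent_space M p"
  by (simp add: tscale_minus_one tangent_space_scale del: uminus_apply)

lemma tangent_space_diff:
  "smooth_manifold M \<Longrightarrow> v \<in> tangent_space M p \<Longrightarrow> w \<in> tangent_space M p \<Longrightarrow> v - w \<in> tangent_space M p"
  using tangent_space_add[OF _ _ tangent_space_uminus] by (metis diff_conv_add_uminus)

lemma tangent_space_sum: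
  "smooth_manifold M \<Longrightarrow> (\<And>i. i \<in> A \<Longrightarrow> v i \<in> tangent_space M p) \<Longrightarrow> (\<Sum>i\<in>A. v i) \<in> tangent_space M p"
  by (induction A rule: infinite_finite_induct)
    (auto intro: tangent_space_add tangent_space_0 simp del: plus_fun_apply)

lemma sum_tvec_apply: "(\<Sum>i\<in>A. v i) c = (\<Sum>i\<in>A. v i c)" for v :: "_ \<Rightarrow> ('m, 'e::euclidean_space) tvec"
  by (induction A rule: infinite_finite_induct) auto

lemma coord_vec_add:
  assumes "smooth_manifold M" "c \<in> charts_at M p"
  shows "coord_vec M c (v + w) p = coord_vec M c v p + coord_vec M c w p"
  using linear_add[OF jac_linear[OF assms]] by (auto simp: coord_vec_def fun_eq_iff)

lemma coord_vec_scale: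
  assumes "smooth_manifold M" "c \<in> charts_at M p"
  shows "coord_vec M c (r *\<^sub>R w) p = r \<odot> coord_vec M c w p"
  using linear_scale[OF jac_linear[OF assms]] by (auto simp: coord_vec_def fun_eq_iff)

lemma tangent_frame:
  assumes "smooth_manifold M" "c \<in> charts_at M p" "v \<in> tangent_space M p"
  shows "v = (\<Sum>b\<in>Basis. (v c \<bullet> b) \<odot> coord_vec M c b p)"
  by (rule tangent_space_eqI[OF assms(3) _ assms(2)])
    (simp_all add: assms coord_vec_tangent tangent_space_scale tangent_space_sum sum_tvec_apply
      coord_vec_chart[OF assms(1,2)] euclidean_representation del: charts_at_iff)

text \<open>The derivative along a tangent vector is defined with some chosen chart; the Jacobian that the chain rule
  produces in passing to \<open>c\<close> is the one by which the components of the vector transform.\<close>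

lemma tderiv_chart:
  assumes M: "smooth_manifold M" and c: "c \<in> charts_at M p" and v: "v \<in> tangent_space M p"
    and h: "(h \<circ> cinv c has_derivative h') (at (cmap c p))"
  shows "tderiv M p v h = h' (v c)"
proof -
  define d where "d = (SOME c. c \<in> charts_at M p)"
  have d: "d \<in> charts_at M p" using c unfolding d_def by (rule someI)
  show ?thesis
    unfolding tderiv_def d_def[symmetric] Let_def
      frechet_derivative_eqI[OF chart_change_derivative[OF M d c h]]
    using tangent_spaceD(1)[OF v d c] by simp
qed

section \<open>Smooth functions and fields\<close>

lemma smooth_fun_chartI:
  assumes M: "smooth_manifold M" and c: "c \<in> atlas M" and U: "openin (mtop M) U" "U \<subseteq> cdom c"
    and f: "smooth_on (cmap c ` U) (f \<circ> cinv c)"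
  shows "smooth_fun M U f"
  unfolding smooth_fun_def
proof
  fix d assume d: "d \<in> atlas M"
  let ?W = "cmap d ` (U \<inter> cdom d)"
  have W: "open ?W" using chart_image_open[OF M d U(1)] .
  have "smooth_on ?W (\<lambda>x. (f \<circ> cinv c) ((cmap c \<circ> cinv d) x))"
    by (rule smooth_on_compose[OF W f smooth_on_subset[OF transition_smooth[OF M d c]]])
      (use M c d U in auto)
  then show "smooth_on ?W (f \<circ> cinv d)"
    by (rule smooth_on_cong[OF W, rotated]) (use M c d U in auto)
qed

lemma smooth_fun_const: "smooth_fun M U (\<lambda>q. r)"
  by (simp add: smooth_fun_def o_def smooth_on_def)

lemma coord_vec_smooth:
  assumes M: "smooth_manifold M" and c: "c \<in> atlas M"
  shows "smooth_vf M (cdom c) (coord_vec M c w)"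
  unfolding smooth_vf_def
proof (intro conjI ballI)
  show "coord_vec M c w p \<in> tangent_space M p" if "p \<in> cdom c" for p
    using that c by (intro coord_vec_tangent[OF M]) simp
  fix d assume d: "d \<in> atlas M"
  let ?W = "cmap d ` (cdom c \<inter> cdom d)"
  have W: "open ?W" using chart_image_open[OF M d chart_openin[OF M c]] .
  have "smooth_on ?W (\<lambda>x. frechet_derivative (cmap d \<circ> cinv c) (at ((cmap c \<circ> cinv d) x)) w)"
    by (rule smooth_on_compose[OF W smooth_on_frechet_derivative[OF transition_smooth[OF M c d]]
          smooth_on_subset[OF transition_smooth[OF M d c]]])
      (use M c d in auto)
  then show "smooth_on ?W (\<lambda>x. coord_vec M c w (cinv d x) d)"
    by (rule smooth_on_cong[OF W, rotated]) (use M c d in \<open>auto simp: coord_vec_def\<close>)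
qed

lemma smooth_vf_subset: "smooth_vf M U X \<Longrightarrow> V \<subseteq> U \<Longrightarrow> smooth_vf M V X"
  unfolding smooth_vf_def by (meson Int_mono image_mono order_refl smooth_on_subset subsetD)

lemma smooth_vf_component:
  assumes M: "smooth_manifold M" and c: "c \<in> atlas M" and U: "openin (mtop M) U" "U \<subseteq> cdom c"
    and X: "smooth_vf M U X"
  shows "smooth_on (cmap c ` U) (\<lambda>x. X (cinv c x) c)" "smooth_fun M U (\<lambda>q. X q c \<bullet> b)"
proof -
  show *: "smooth_on (cmap c ` U) (\<lambda>x. X (cinv c x) c)"
    using X c U(2) unfolding smooth_vf_def by (metis Int_absorb2)
  have "open (cmap c ` U)" using chart_image_open[OF M c U(1)] U(2) by (simp add: Int_absorb2)
  from smooth_on_inner_left[OF this *] show "smooth_fun M U (\<lambda>q. X q c \<bullet> b)"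
    by (intro smooth_fun_chartI[OF M c U]) (simp add: o_def)
qed

lemma smooth_vf_scale:
  assumes M: "smooth_manifold M" and U: "openin (mtop M) U"
    and f: "smooth_fun M U f" and X: "smooth_vf M U X"
  shows "smooth_vf M U (\<lambda>q. f q \<odot> X q)"
  unfolding smooth_vf_def
proof (intro conjI ballI)
  show "f p \<odot> X p \<in> tangent_space M p" if "p \<in> U" for p
    using that X by (auto simp: smooth_vf_def intro: tangent_space_scale[OF M])
  fix c assume c: "c \<in> atlas M"
  show "smooth_on (cmap c ` (U \<inter> cdom c)) (\<lambda>x. (f (cinv c x) \<odot> X (cinv c x)) c)"
    unfolding tscale_def using f X c by (intro smooth_on_scaleR chart_image_open[OF M c U])
      (auto simp: smooth_fun_def smooth_vf_def o_def)
qed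

lemma smooth_vf_sum:
  assumes M: "smooth_manifold M" and U: "openin (mtop M) U" and "finite A"
    and X: "\<And>i. i \<in> A \<Longrightarrow> smooth_vf M U (X i)"
  shows "smooth_vf M U (\<lambda>q. \<Sum>i\<in>A. X i q)"
  unfolding smooth_vf_def
proof (intro conjI ballI)
  show "(\<Sum>i\<in>A. X i p) \<in> tangent_space M p" if "p \<in> U" for p
    using that X by (auto simp: smooth_vf_def intro: tangent_space_sum[OF M])
  fix c assume c: "c \<in> atlas M"
  show "smooth_on (cmap c ` (U \<inter> cdom c)) (\<lambda>x. (\<Sum>i\<in>A. X i (cinv c x)) c)"
    unfolding smooth_on_def sum_tvec_apply
    using X c by (intro allI Ck_on_sum chart_image_open[OF M c U])
      (auto simp: smooth_vf_def smooth_on_def)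
qed

text \<open>A coordinate field with constant components is cut off by a bump function. It vanishes outside the
  preimage of a closed ball, which is compact and therefore closed, the manifold being Hausdorff; so the
  field is smooth on two open sets that cover the manifold, the chart domain and the complement of
  this preimage.\<close>

lemma extend_tangent_vector:
  fixes M :: "('m, 'e::euclidean_space) mfd"
  assumes M: "smooth_manifold M" and p: "p \<in> pts M" and v: "v \<in> tangent_space M p"
  obtains X where "smooth_vf M (pts M) X" "X p = v"
proof -
  obtain c where c: "c \<in> atlas M" "p \<in> cdom c" using chart_exists[OF M p] .
  let ?O = "cmap c ` cdom c"
  have "open ?O" using M c by (simp add: smooth_manifold_def)
  then obtain r where r: "r > 0" "cball (cmap c p) r \<subseteq> ?O"
    using c open_contains_cball by blast
  obtain \<beta> :: "'e \<Rightarrow> real" where \<beta>: "smooth_on UNIV \<beta>" "\<beta> (cmap c p) = 1"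
    "\<And>x. dist (cmap c p) x \<ge> r \<Longrightarrow> \<beta> x = 0"
    using smooth_bump[OF r(1), of "cmap c p"] by metis
  define K where "K = {q \<in> cdom c. cmap c q \<in> cball (cmap c p) r}"
  define X where "X q = (if q \<in> cdom c then \<beta> (cmap c q) \<odot> coord_vec M c (v c) q else 0)" for q
  have "cmap c ` K = cball (cmap c p) r" using r(2) by (auto simp: K_def)
  then have "compactin (top_of_set ?O) (cmap c ` K)"
    using r(2) by (simp add: compactin_subtopology)
  then have "compactin (subtopology (mtop M) (cdom c)) K"
    using homeomorphic_map_compactness_eq[OF chart_homeomorphic[OF M c(1)], of K]
      chart_openin[OF M c(1), THEN openin_subset]
    by (auto simp: K_def)
  then have "compactin (mtop M) K" by (simp add: compactin_subtopology)
  then have "closedin (mtop M) K"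
    using M compactin_imp_closedin by (auto simp: smooth_manifold_def)
  then have K: "openin (mtop M) (pts M - K)" by blast
  have f: "smooth_fun M (cdom c) (\<lambda>q. \<beta> (cmap c q))"
  proof (rule smooth_fun_chartI[OF M c(1) chart_openin[OF M c(1)] order_refl])
    show "smooth_on ?O ((\<lambda>q. \<beta> (cmap c q)) \<circ> cinv c)"
      by (rule smooth_on_cong[OF \<open>open ?O\<close> _ smooth_on_subset[OF \<beta>(1)]]) (use M c in auto)
  qed
  have X1: "smooth_vf M (cdom c) (\<lambda>q. \<beta> (cmap c q) \<odot> coord_vec M c (v c) q)"
    using smooth_vf_scale[OF M chart_openin[OF M c(1)] f coord_vec_smooth[OF M c(1)]] .
  have X0: "X q = 0" if "q \<notin> K" for q
  proof (cases "q \<in> cdom c")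
    case True
    then show ?thesis using that \<beta>(3)[of "cmap c q"] by (auto simp: K_def X_def)
  qed (simp add: X_def)
  have "smooth_vf M (pts M) X"
    unfolding smooth_vf_def
  proof (intro conjI ballI)
    show "X q \<in> tangent_space M q" for q
      using X1 tangent_space_0[OF M] by (auto simp: X_def smooth_vf_def)
    fix d assume d: "d \<in> atlas M"
    let ?A = "cmap d ` (cdom c \<inter> cdom d)" and ?B = "cmap d ` ((pts M - K) \<inter> cdom d)"
    have A: "open ?A" and B: "open ?B"
      using chart_image_open[OF M d] chart_openin[OF M c(1)] K by auto
    have 1: "smooth_on ?A (\<lambda>x. X (cinv d x) d)"
      by (rule smooth_on_cong[OF A, of "\<lambda>x. (\<beta> (cmap c (cinv d x)) \<odot> coord_vec M c (v c) (cinv d x)) d"])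
        (use X1 d M in \<open>auto simp: smooth_vf_def X_def\<close>)
    have 2: "smooth_on ?B (\<lambda>x. X (cinv d x) d)"
      by (rule smooth_on_cong[OF B, of "\<lambda>x. 0"]) (use d M in \<open>auto simp: X0 smooth_on_def\<close>)
    have "cmap d ` (pts M \<inter> cdom d) = ?A \<union> ?B"
      using chart_pts[OF M c(1)] by (auto simp: K_def)
    then show "smooth_on (cmap d ` (pts M \<inter> cdom d)) (\<lambda>x. X (cinv d x) d)"
      using 1 2 A B unfolding smooth_on_def by (auto intro: Ck_on_Un)
  qed
  moreover have "X p = v"
    using c \<beta>(2) tangent_eq_coord_vec[OF M _ v, of c] by (simp add: X_def)
  ultimately show ?thesis using that by blast
qed

section \<open>Connections in a chart\<close>

lemma tderiv_const: "tderiv M p v (\<lambda>q. r) = 0"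
  by (simp add: tderiv_def Let_def o_def)

lemma affine_connectionD:
  assumes "affine_connection M nab" "openin (mtop M) U" "smooth_vf M U Y" "p \<in> U" "v \<in> tangent_space M p"
  shows nab_tangent: "nab Y p v \<in> tangent_space M p"
    and nab_add_dir: "w \<in> tangent_space M p \<Longrightarrow> nab Y p (v + w) = nab Y p v + nab Y p w"
    and nab_scale_dir: "nab Y p (r \<odot> v) = r \<odot> nab Y p v"
    and nab_add: "smooth_vf M U Z \<Longrightarrow> nab (\<lambda>q. Y q + Z q) p v = nab Y p v + nab Z p v"
    and nab_mult: "smooth_fun M U f \<Longrightarrow>
      nab (\<lambda>q. f q \<odot> Y q) p v = tderiv M p v f \<odot> Y p + f p \<odot> nab Y p v"
    and nab_local: "(\<And>q. q \<in> U \<Longrightarrow> Z q = Y q) \<Longrightarrow> nab Z p v = nab Y p v"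
proof -
  note * = assms(1)[unfolded affine_connection_def, THEN spec, THEN spec, THEN mp, OF conjI, OF assms(2,3)]
  have point: "P p v" if "\<forall>p\<in>U. \<forall>v\<in>tangent_space M p. P p v" for P
    using that assms(4,5) by blast
  note dir = point[OF conjunct1[OF *], THEN bspec, THEN spec]
  note * = conjunct2[OF *]
  show "nab Y p v \<in> tangent_space M p" using dir[OF assms(5), of 0] by (elim conjE)
  show "nab Y p (v + w) = nab Y p v + nab Y p w" if "w \<in> tangent_space M p"
    using dir[OF that, of 0] by (elim conjE)
  show "nab Y p (r \<odot> v) = r \<odot> nab Y p v" using dir[OF assms(5), of r] by (elim conjE)
  show "nab (\<lambda>q. Y q + Z q) p v = nab Y p v + nab Z p v" if "smooth_vf M U Z"
    by (rule point[OF conjunct1[OF *, THEN spec, THEN mp, OF that]])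
  note * = conjunct2[OF *]
  show "nab (\<lambda>q. f q \<odot> Y q) p v = tderiv M p v f \<odot> Y p + f p \<odot> nab Y p v" if "smooth_fun M U f"
    by (rule point[OF conjunct1[OF *, THEN spec, THEN mp, OF that]])
  note * = conjunct2[OF *]
  show "nab Z p v = nab Y p v" if "\<And>q. q \<in> U \<Longrightarrow> Z q = Y q"
    by (rule point[OF conjunct1[OF *, THEN spec, THEN mp, OF ballI[OF that]]])
qed

lemma nab_sum:
  assumes M: "smooth_manifold M" and nab: "affine_connection M nab" and U: "openin (mtop M) U"
    and "finite A" and Y: "\<And>i. i \<in> A \<Longrightarrow> smooth_vf M U (Y i)" and p: "p \<in> U"
    and v: "v \<in> tangent_space M p"
  shows "nab (\<lambda>q. \<Sum>i\<in>A. Y i q) p v = (\<Sum>i\<in>A. nab (Y i) p v)"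
  using \<open>finite A\<close> Y
proof (induction A rule: finite_induct)
  case empty
  have "smooth_vf M U (\<lambda>q. 0)" using smooth_vf_sum[OF M U, of "{}" "\<lambda>i q. 0"] by simp
  from nab_add[OF nab U this p v this] show ?case by (simp del: zero_fun_apply plus_fun_apply)
next
  case (insert i A)
  have "smooth_vf M U (\<lambda>q. \<Sum>i\<in>A. Y i q)"
    by (rule smooth_vf_sum[OF M U]) (use insert in auto)
  from nab_add[OF nab U _ p v this, of "Y i"] insert show ?case by (simp del: plus_fun_apply)
qed

text \<open>The Leibniz rule applied to the expansion of \<open>Y\<close> in the coordinate frame of the chart.\<close>

lemma nab_frame:
  fixes M :: "('m, 'e::euclidean_space) mfd"
  assumes M: "smooth_manifold M" and nab: "affine_connection M nab" and c: "c \<in> atlas M"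
    and U: "openin (mtop M) U" "U \<subseteq> cdom c" and Y: "smooth_vf M U Y" and p: "p \<in> U"
    and v: "v \<in> tangent_space M p"
  shows "nab Y p v = (\<Sum>b\<in>Basis. tderiv M p v (\<lambda>q. Y q c \<bullet> b) \<odot> coord_vec M c b p
      + (Y p c \<bullet> b) \<odot> nab (coord_vec M c b) p v)"
proof -
  let ?Z = "\<lambda>b q. (Y q c \<bullet> b) \<odot> coord_vec M c b q"
  have E: "smooth_vf M U (coord_vec M c b)" for b
    using smooth_vf_subset[OF coord_vec_smooth[OF M c] U(2)] .
  note f = smooth_vf_component(2)[OF M c U Y]
  have Z: "smooth_vf M U (?Z b)" for b by (rule smooth_vf_scale[OF M U(1) f E])
  have "nab Y p v = nab (\<lambda>q. \<Sum>b\<in>Basis. ?Z b q) p v"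
  proof (rule nab_local[OF nab U(1) _ p v])
    show "smooth_vf M U (\<lambda>q. \<Sum>b\<in>Basis. ?Z b q)" by (rule smooth_vf_sum[OF M U(1)]) (auto intro: Z)
    show "Y q = (\<Sum>b\<in>Basis. ?Z b q)" if "q \<in> U" for q
      by (rule tangent_frame[OF M]) (use that c U Y in \<open>auto simp: smooth_vf_def\<close>)
  qed
  also have "\<dots> = (\<Sum>b\<in>Basis. nab (?Z b) p v)"
    by (rule nab_sum[OF M nab U(1) finite_Basis Z p v])
  also have "\<dots> = (\<Sum>b\<in>Basis. tderiv M p v (\<lambda>q. Y q c \<bullet> b) \<odot> coord_vec M c b p
      + (Y p c \<bullet> b) \<odot> nab (coord_vec M c b) p v)"
    by (intro sum.cong refl nab_mult[OF nab U(1) E p v f])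
  finally show ?thesis .
qed

lemma nab_coord_vec_linear:
  assumes M: "smooth_manifold M" and nab: "affine_connection M nab" and c: "c \<in> charts_at M p"
    and v: "v \<in> tangent_space M p"
  shows "linear (\<lambda>w. nab (coord_vec M c w) p v d)"
proof -
  have U: "c \<in> atlas M" "p \<in> cdom c" using c by auto
  note U' = chart_openin[OF M U(1)]
  note E = coord_vec_smooth[OF M U(1)]
  show ?thesis
  proof (rule linearI)
    fix w w' r
    have "nab (coord_vec M c (w + w')) p v = nab (\<lambda>q. coord_vec M c w q + coord_vec M c w' q) p v"
    proof (rule nab_local[OF nab U' E U(2) v, symmetric])
      fix q assume "q \<in> cdom c"
      then show "coord_vec M c w q + coord_vec M c w' q = coord_vec M c (w + w') q"
        using coord_vec_add[OF M] U(1) by (metis charts_at_iff)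
    qed
    then show "nab (coord_vec M c (w + w')) p v d = nab (coord_vec M c w) p v d + nab (coord_vec M c w') p v d"
      using nab_add[OF nab U' E U(2) v E] by simp
    have "nab (coord_vec M c (r *\<^sub>R w)) p v = nab (\<lambda>q. r \<odot> coord_vec M c w q) p v"
    proof (rule nab_local[OF nab U' E U(2) v, symmetric])
      fix q assume "q \<in> cdom c"
      then show "r \<odot> coord_vec M c w q = coord_vec M c (r *\<^sub>R w) q"
        using coord_vec_scale[OF M] U(1) by (metis charts_at_iff)
    qed
    then show "nab (coord_vec M c (r *\<^sub>R w)) p v d = r *\<^sub>R nab (coord_vec M c w) p v d"
      using nab_mult[OF nab U' E U(2) v smooth_fun_const] by (simp add: tderiv_const)
  qed
qed

lemma linear_basis_expansion:
  fixes L :: "'a::euclidean_space \<Rightarrow> 'b::real_vector"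
  assumes "linear L" shows "(\<Sum>b\<in>Basis. (w \<bullet> b) *\<^sub>R L b) = L w"
proof -
  have "L w = L (\<Sum>b\<in>Basis. (w \<bullet> b) *\<^sub>R b)" by (simp add: euclidean_representation)
  then show ?thesis by (simp add: linear_sum[OF assms] linear_scale[OF assms])
qed

text \<open>The derivative of the components plus the Christoffel term. For a coordinate field \<open>Y\<close> of another chart
  this is the transformation law of the Christoffel symbols.\<close>

lemma nab_chart:
  assumes M: "smooth_manifold M" and nab: "affine_connection M nab" and c: "c \<in> atlas M"
    and U: "openin (mtop M) U" "U \<subseteq> cdom c" and Y: "smooth_vf M U Y" and p: "p \<in> U"
    and v: "v \<in> tangent_space M p"
  shows "nab Y p v c = frechet_derivative (\<lambda>x. Y (cinv c x) c) (at (cmap c p)) (v c)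
      + nab (coord_vec M c (Y p c)) p v c"
proof -
  let ?y = "\<lambda>x. Y (cinv c x) c"
  have cp: "c \<in> charts_at M p" using c p U by auto
  have y: "(?y has_derivative frechet_derivative ?y (at (cmap c p))) (at (cmap c p))"
    by (rule smooth_on_has_derivative[OF smooth_vf_component(1)[OF M c U Y]]) (use p in auto)
  have t: "tderiv M p v (\<lambda>q. Y q c \<bullet> b) = frechet_derivative ?y (at (cmap c p)) (v c) \<bullet> b" for b
    by (rule tderiv_chart[OF M cp v]) (use has_derivative_inner_left[OF y] in \<open>simp add: o_def\<close>)
  have "nab Y p v c = (\<Sum>b\<in>Basis. (frechet_derivative ?y (at (cmap c p)) (v c) \<bullet> b) *\<^sub>R b)
     + (\<Sum>b\<in>Basis. (Y p c \<bullet> b) *\<^sub>R nab (coord_vec M c b) p v c)"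
    by (subst nab_frame[OF M nab c U Y p v])
      (simp add: sum_tvec_apply coord_vec_chart[OF M cp] t sum.distrib)
  then show ?thesis
    by (simp add: euclidean_representation linear_basis_expansion[OF nab_coord_vec_linear[OF M nab cp v]])
qed

lemma levi_civita_affine: "levi_civita M g nab \<Longrightarrow> affine_connection M nab"
  by (simp add: levi_civita_def)

text \<open>The symmetry of the Christoffel symbols: coordinate fields of one chart commute, and the connection
  is torsion-free.\<close>

lemma nab_coord_vec_symmetric:
  assumes M: "smooth_manifold M" and nab: "levi_civita M g nab" and c: "c \<in> charts_at M p"
  shows "nab (coord_vec M c w) p (coord_vec M c v p) = nab (coord_vec M c v) p (coord_vec M c w p)"
proof -
  have U: "c \<in> atlas M" "p \<in> cdom c" using c by auto
  note U' = chart_openin[OF M U(1)]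
  note E = coord_vec_smooth[OF M U(1)]
  note T = coord_vec_tangent[OF M c]
  have const: "tderiv M p u (\<lambda>q. coord_vec M c w q c) = 0" if "u \<in> tangent_space M p" for u w
  proof (rule tderiv_chart[OF M c that, where h' = "\<lambda>_. 0"])
    have "open (cmap c ` cdom c)" using M U(1) by (simp add: smooth_manifold_def)
    with has_derivative_const show "((\<lambda>q. coord_vec M c w q c) \<circ> cinv c has_derivative (\<lambda>_. 0)) (at (cmap c p))"
    proof (rule has_derivative_transform_within_open)
      show "cmap c p \<in> cmap c ` cdom c" using U by simp
      fix x assume "x \<in> cmap c ` cdom c"
      then obtain q where q: "q \<in> cdom c" "x = cmap c q" by blast
      then show "w = ((\<lambda>q. coord_vec M c w q c) \<circ> cinv c) x"
        using U(1) coord_vec_chart[OF M, of c q] by (simp add: chart_cinv[OF M U(1)])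
    qed
  qed
  have "nab (coord_vec M c w) p (coord_vec M c v p) - nab (coord_vec M c v) p (coord_vec M c w p)
      = lie_bracket M (coord_vec M c v) (coord_vec M c w) p"
    by (rule nab[unfolded levi_civita_def, THEN conjunct2, THEN conjunct1, THEN spec, THEN spec,
        THEN spec, THEN mp, THEN bspec]) (use U U' E in auto)
  then have "(nab (coord_vec M c w) p (coord_vec M c v p) - nab (coord_vec M c v) p (coord_vec M c w p)) c = 0"
    using c by (simp add: lie_bracket_def const T)
  moreover note nt = nab_tangent[OF levi_civita_affine[OF nab] U' E U(2) T]
  ultimately show ?thesis by (intro tangent_space_eqI[OF nt nt c]) simp
qed

section \<open>The metric as an inner product\<close>

lemma metricD:
  assumes "riemannian_manifold M g" "p \<in> pts M" "u \<in> tangent_space M p" "w \<in> tangent_space M p"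
  shows metric_add_left: "v \<in> tangent_space M p \<Longrightarrow> g p (u + v) w = g p u w + g p v w"
    and metric_scale_left: "g p (r \<odot> u) w = r * g p u w"
    and metric_sym: "g p u w = g p w u"
    and metric_pos: "u \<noteq> 0 \<Longrightarrow> g p u u > 0"
proof -
  note * = assms(1)[unfolded riemannian_manifold_def, THEN conjunct2, THEN conjunct1, THEN bspec,
      OF assms(2), THEN bspec, OF assms(3), THEN bspec, THEN bspec, THEN spec]
  show "g p (u + v) w = g p u w + g p v w" if "v \<in> tangent_space M p"
    using *[OF that assms(4), of 0] by (elim conjE)
  show "g p (r \<odot> u) w = r * g p u w" using *[OF assms(4,4), of r] by (elim conjE)
  show "g p u w = g p w u" using *[OF assms(4,4), of 0] by (elim conjE)
  show "g p u u > 0" if "u \<noteq> 0" using *[OF assms(3,3), of 0] that by (elim conjE) (rule mp)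
qed

lemma riemannian_smooth: "riemannian_manifold M g \<Longrightarrow> smooth_manifold M"
  by (simp add: riemannian_manifold_def)

context
  fixes M :: "('m, 'e::euclidean_space) mfd" and g and p
  assumes g: "riemannian_manifold M g" and p: "p \<in> pts M"
begin

lemma metric_add_right:
  assumes "u \<in> tangent_space M p" "v \<in> tangent_space M p" "w \<in> tangent_space M p"
  shows "g p w (u + v) = g p w u + g p w v"
  using assms metric_add_left[OF g p] metric_sym[OF g p] tangent_space_add[OF riemannian_smooth[OF g]]
  by metis

lemma metric_scale_right:
  assumes "u \<in> tangent_space M p" "w \<in> tangent_space M p"
  shows "g p w (r \<odot> u) = r * g p w u"
  using assms metric_scale_left[OF g p] metric_sym[OF g p] tangent_space_scale[OF riemannian_smooth[OF g]]
  by metis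

lemma metric_zero_left: "w \<in> tangent_space M p \<Longrightarrow> g p 0 w = 0"
  using metric_scale_left[OF g p tangent_space_0[OF riemannian_smooth[OF g]], of w 0] by simp

lemma metric_sum_left:
  assumes "\<And>i. i \<in> A \<Longrightarrow> u i \<in> tangent_space M p" "w \<in> tangent_space M p"
  shows "g p (\<Sum>i\<in>A. u i) w = (\<Sum>i\<in>A. g p (u i) w)"
  using assms(1)
proof (induction A rule: infinite_finite_induct)
  case (insert i A)
  then show ?case
    using metric_add_left[OF g p _ assms(2), of "u i" "\<Sum>i\<in>A. u i"]
      tangent_space_sum[OF riemannian_smooth[OF g], of A u p]
    by (simp del: plus_fun_apply)
qed (simp_all add: metric_zero_left[OF assms(2)] del: zero_fun_apply)

lemma metric_sum_right:
  assumes "\<And>i. i \<in> A \<Longrightarrow> u i \<in> tangent_space M p" "w \<in> tangent_space M p"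
  shows "g p w (\<Sum>i\<in>A. u i) = (\<Sum>i\<in>A. g p w (u i))"
proof -
  have "(\<Sum>i\<in>A. u i) \<in> tangent_space M p"
    using assms(1) by (rule tangent_space_sum[OF riemannian_smooth[OF g]])
  then have "g p w (\<Sum>i\<in>A. u i) = (\<Sum>i\<in>A. g p (u i) w)"
    using metric_sym[OF g p assms(2)] metric_sum_left[of A u w] assms by simp
  then show ?thesis using metric_sym[OF g p] assms by simp
qed

lemma metric_diff_left:
  assumes "u \<in> tangent_space M p" "v \<in> tangent_space M p" "w \<in> tangent_space M p"
  shows "g p (u - v) w = g p u w - g p v w"
proof -
  have "u - v \<in> tangent_space M p" using tangent_space_diff[OF riemannian_smooth[OF g] assms(1,2)] .
  from metric_add_left[OF g p this assms(3,2)] show ?thesis by simp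
qed

lemma metric_eq_0D: "u \<in> tangent_space M p \<Longrightarrow> g p u u = 0 \<Longrightarrow> u = 0"
  using metric_pos[OF g p] by force

end

lemma metric_smooth:
  assumes "riemannian_manifold M g" "openin (mtop M) U" "smooth_vf M U X" "smooth_vf M U Y"
  shows "smooth_fun M U (\<lambda>q. g q (X q) (Y q))"
  by (rule assms(1)[unfolded riemannian_manifold_def, THEN conjunct2, THEN conjunct2, THEN spec,
        THEN spec, THEN spec, THEN mp]) (use assms in auto)

lemma levi_civita_metric:
  assumes "levi_civita M g nab" "openin (mtop M) U" "smooth_vf M U X" "smooth_vf M U Y"
    "smooth_vf M U Z" "p \<in> U"
  shows "tderiv M p (X p) (\<lambda>q. g q (Y q) (Z q)) =
           g p (nab Y p (X p)) (Z p) + g p (Y p) (nab Z p (X p))"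
  by (rule assms(1)[unfolded levi_civita_def, THEN conjunct2, THEN conjunct2, THEN spec, THEN spec,
        THEN spec, THEN spec, THEN mp, THEN bspec]) (use assms in auto)

section \<open>Fields along a hypersurface\<close>

lemma chart_has_derivative_transform:
  assumes M: "smooth_manifold M" and c: "c \<in> charts_at M p"
    and h: "(h has_derivative h') (at (cmap c p))" and U: "openin (mtop M) U" "p \<in> U"
    and eq: "\<And>q. q \<in> U \<Longrightarrow> q \<in> cdom c \<Longrightarrow> h (cmap c q) = k (cmap c q)"
  shows "(k has_derivative h') (at (cmap c p))"
proof (rule has_derivative_transform_within_open[OF h])
  show "open (cmap c ` (U \<inter> cdom c))" using c by (intro chart_image_open[OF M _ U(1)]) simp
qed (use c U eq in auto)

lemma charts_at_pts: "smooth_manifold M \<Longrightarrow> c \<in> charts_at M p \<Longrightarrow> p \<in> pts M"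
  by (auto intro: chart_pts)

lemma coord_vec_jac: "d \<in> charts_at M p \<Longrightarrow> coord_vec M c w p d = jac c d p w"
  by (simp add: coord_vec_def)

lemma metric_frame_right:
  assumes g: "riemannian_manifold M g" and c: "c \<in> charts_at M p"
    and u: "u \<in> tangent_space M p" and w: "w \<in> tangent_space M p"
  shows "g p u w = (\<Sum>b\<in>Basis. (w c \<bullet> b) * g p u (coord_vec M c b p))"
proof -
  note M = riemannian_smooth[OF g]
  have p: "p \<in> pts M" using charts_at_pts[OF M c] .
  have "g p u w = g p u (\<Sum>b\<in>Basis. (w c \<bullet> b) \<odot> coord_vec M c b p)"
    using tangent_frame[OF M c w] by (rule arg_cong)
  also have "\<dots> = (\<Sum>b\<in>Basis. (w c \<bullet> b) * g p u (coord_vec M c b p))"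
    using u coord_vec_tangent[OF M c] tangent_space_scale[OF M]
    by (simp add: metric_sum_right[OF g p] metric_scale_right[OF g p])
  finally show ?thesis .
qed

lemma metric_frame_left:
  assumes g: "riemannian_manifold M g" and c: "c \<in> charts_at M p"
    and u: "u \<in> tangent_space M p" and w: "w \<in> tangent_space M p"
  shows "g p u w = (\<Sum>b\<in>Basis. (u c \<bullet> b) * g p (coord_vec M c b p) w)"
proof -
  note M = riemannian_smooth[OF g]
  have p: "p \<in> pts M" using charts_at_pts[OF M c] .
  show ?thesis
    using metric_frame_right[OF g c w u] metric_sym[OF g p] u w coord_vec_tangent[OF M c] by simp
qed

locale immersed_hypersurface =
  fixes M :: "('m, 'e::euclidean_space) mfd" and g :: "('m, 'e) metric"
    and nab :: "('m, 'e) connection" and S :: "('m, 'f::euclidean_space) mfd"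
  assumes riem: "riemannian_manifold M g" and lc: "levi_civita M g nab"
    and hyp: "hypersurface M S"
begin

lemma smooth_M: "smooth_manifold M" using riem by (rule riemannian_smooth)
lemma smooth_S: "smooth_manifold S" using hyp by (simp add: hypersurface_def)
lemma affine: "affine_connection M nab" using lc by (rule levi_civita_affine)
lemma pts_S_M: "p \<in> pts S \<Longrightarrow> p \<in> pts M" using hyp by (auto simp: hypersurface_def)

lemma openin_restrict:
  assumes "openin (mtop M) W" shows "openin (mtop S) (pts S \<inter> W)"
proof -
  have "continuous_map (mtop S) (mtop M) (\<lambda>p. p)" using hyp by (simp add: hypersurface_def)
  from openin_continuous_map_preimage[OF this assms] show ?thesis by (simp add: Collect_conj_eq)
qed

lemma chart_S_pts: "s \<in> charts_at S p \<Longrightarrow> p \<in> pts S"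
  by (rule charts_at_pts[OF smooth_S])

abbreviation incl_jac :: "('m, 'f) chart \<Rightarrow> ('m, 'e) chart \<Rightarrow> 'm \<Rightarrow> 'f \<Rightarrow> 'e" where
  "incl_jac s c p \<equiv> frechet_derivative (cmap c \<circ> cinv s) (at (cmap s p))"

lemma incl_smooth:
  "s \<in> atlas S \<Longrightarrow> c \<in> atlas M \<Longrightarrow> smooth_on (cmap s ` (cdom s \<inter> cdom c)) (cmap c \<circ> cinv s)"
  using hyp by (simp add: hypersurface_def)

lemma incl_overlap_open:
  assumes "s \<in> atlas S" "c \<in> atlas M"
  shows "openin (mtop S) (cdom s \<inter> cdom c)" "open (cmap s ` (cdom s \<inter> cdom c))"
proof -
  have "cdom s \<inter> cdom c = cdom s \<inter> (pts S \<inter> cdom c)"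
    using chart_pts[OF smooth_S assms(1)] by blast
  then show "openin (mtop S) (cdom s \<inter> cdom c)"
    using chart_openin[OF smooth_S assms(1)] openin_restrict[OF chart_openin[OF smooth_M assms(2)]] by auto
  from chart_image_open[OF smooth_S assms(1) this] show "open (cmap s ` (cdom s \<inter> cdom c))"
    by (simp add: Int_assoc Int_commute[of _ "cdom s"])
qed

lemma incl_has_derivative:
  assumes "s \<in> charts_at S p" "c \<in> charts_at M p"
  shows "(cmap c \<circ> cinv s has_derivative incl_jac s c p) (at (cmap s p))"
  by (rule smooth_on_has_derivative[OF incl_smooth]) (use assms in auto)

text \<open>The chain rule for the restriction of a function from \<open>M\<close> to \<open>S\<close>.\<close>

lemma restrict_derivative:
  assumes s: "s \<in> charts_at S p" and c: "c \<in> charts_at M p"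
    and h: "(h \<circ> cinv c has_derivative h') (at (cmap c p))"
  shows "((\<lambda>x. h (cinv s x)) has_derivative (\<lambda>y. h' (incl_jac s c p y))) (at (cmap s p))"
proof -
  have cinv_s: "cinv s (cmap s q) = q" if "q \<in> cdom s" for q
    using s that by (intro chart_cinv[OF smooth_S]) auto
  have cinv_c: "cinv c (cmap c q) = q" if "q \<in> cdom c" for q
    using c that by (intro chart_cinv[OF smooth_M]) auto
  have e: "(cmap c \<circ> cinv s) (cmap s p) = cmap c p" using s cinv_s by simp
  have "((\<lambda>x. (h \<circ> cinv c) ((cmap c \<circ> cinv s) x)) has_derivative (\<lambda>y. h' (incl_jac s c p y))) (at (cmap s p))"
    by (rule has_derivative_compose[OF incl_has_derivative[OF s c]]) (simp only: e h)
  then show ?thesis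
    by (rule chart_has_derivative_transform[OF smooth_S s, where U = "cdom s \<inter> cdom c"])
      (use s c incl_overlap_open(1) cinv_s cinv_c in auto)
qed

lemma incl_chart:
  assumes s: "s \<in> charts_at S p" and c: "c \<in> charts_at M p" and \<xi>: "\<xi> \<in> tangent_space S p"
  shows "incl S M p \<xi> c = incl_jac s c p (\<xi> s)"
  using tderiv_chart[OF smooth_S s \<xi> incl_has_derivative[OF s c]] c by (simp add: incl_def)

lemma incl_tangent:
  assumes p: "p \<in> pts S" and \<xi>: "\<xi> \<in> tangent_space S p"
  shows "incl S M p \<xi> \<in> tangent_space M p"
proof (rule tangent_spaceI)
  obtain s where s: "s \<in> charts_at S p" using chart_exists[OF smooth_S p] by (metis charts_at_iff)
  fix c d assume cd: "c \<in> charts_at M p" "d \<in> charts_at M p"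
  have "((\<lambda>x. cmap d (cinv s x)) has_derivative (\<lambda>y. jac c d p (incl_jac s c p y))) (at (cmap s p))"
    by (rule restrict_derivative[OF s cd(1) jac_has_derivative[OF smooth_M cd]])
  then have "incl_jac s d p = (\<lambda>y. jac c d p (incl_jac s c p y))"
    by (intro frechet_derivative_eqI) (simp add: o_def)
  then show "incl S M p \<xi> d = jac c d p (incl S M p \<xi> c)"
    by (simp only: incl_chart[OF s cd(1) \<xi>] incl_chart[OF s cd(2) \<xi>])
qed (simp add: incl_def del: charts_at_iff)

lemma incl_linear:
  assumes p: "p \<in> pts S" and \<xi>: "\<xi> \<in> tangent_space S p" and \<eta>: "\<eta> \<in> tangent_space S p"
  shows incl_add: "incl S M p (\<xi> + \<eta>) = incl S M p \<xi> + incl S M p \<eta>"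
    and incl_scale: "incl S M p (r \<odot> \<xi>) = r \<odot> incl S M p \<xi>"
proof -
  obtain s where s: "s \<in> charts_at S p" using chart_exists[OF smooth_S p] by (metis charts_at_iff)
  obtain c where c: "c \<in> charts_at M p"
    using chart_exists[OF smooth_M pts_S_M[OF p]] by (metis charts_at_iff)
  note L = has_derivative_linear[OF incl_has_derivative[OF s c]]
  note 1 = tangent_space_add[OF smooth_S \<xi> \<eta>]
  show "incl S M p (\<xi> + \<eta>) = incl S M p \<xi> + incl S M p \<eta>"
    by (rule tangent_space_eqI[OF incl_tangent[OF p 1]
          tangent_space_add[OF smooth_M incl_tangent[OF p \<xi>] incl_tangent[OF p \<eta>]] c])
      (simp add: incl_chart[OF s c 1] incl_chart[OF s c \<xi>] incl_chart[OF s c \<eta>] linear_add[OF L])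
  note 2 = tangent_space_scale[OF smooth_S \<xi>, of r]
  show "incl S M p (r \<odot> \<xi>) = r \<odot> incl S M p \<xi>"
    by (rule tangent_space_eqI[OF incl_tangent[OF p 2]
          tangent_space_scale[OF smooth_M incl_tangent[OF p \<xi>]] c])
      (simp add: incl_chart[OF s c 2] incl_chart[OF s c \<xi>] linear_scale[OF L])
qed

lemma incl_zero: "p \<in> pts S \<Longrightarrow> incl S M p 0 = 0"
  using incl_scale[of p 0 0 0] tangent_space_0[OF smooth_S] by simp

lemma incl_inject:
  "p \<in> pts S \<Longrightarrow> \<xi> \<in> tangent_space S p \<Longrightarrow> \<eta> \<in> tangent_space S p \<Longrightarrow>
    incl S M p \<xi> = incl S M p \<eta> \<Longrightarrow> \<xi> = \<eta>"
  using hyp by (auto simp: hypersurface_def dest: inj_onD)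

text \<open>The product rule will be applied to fields that are defined only near a point, such as the coordinate
  fields of a chart of \<open>S\<close>. This is why only a condition near \<open>p\<close>, in one chart of \<open>S\<close>, is imposed.\<close>

definition differentiable_along :: "('m, 'f) chart \<Rightarrow> ('m \<Rightarrow> ('m, 'e) tvec) \<Rightarrow> 'm \<Rightarrow> bool" where
  "differentiable_along s V p \<longleftrightarrow>
     (\<exists>U. openin (mtop S) U \<and> p \<in> U \<and> (\<forall>q\<in>U. V q \<in> tangent_space M q)) \<and>
     (\<forall>c\<in>charts_at M p. (\<lambda>x. V (cinv s x) c) differentiable (at (cmap s p)))"

abbreviation comp_deriv :: "('m, 'f) chart \<Rightarrow> ('m, 'e) chart \<Rightarrow> ('m \<Rightarrow> ('m, 'e) tvec) \<Rightarrow> 'm \<Rightarrow> 'f \<Rightarrow> 'e" where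
  "comp_deriv s c V p \<equiv> frechet_derivative (\<lambda>x. V (cinv s x) c) (at (cmap s p))"

lemma differentiable_alongD:
  assumes "differentiable_along s V p"
  obtains U where "openin (mtop S) U" "p \<in> U" "\<And>q. q \<in> U \<Longrightarrow> V q \<in> tangent_space M q"
  using assms unfolding differentiable_along_def by blast

lemma differentiable_along_tangent: "differentiable_along s V p \<Longrightarrow> V p \<in> tangent_space M p"
  unfolding differentiable_along_def by blast

lemma comp_has_derivative:
  "differentiable_along s V p \<Longrightarrow> c \<in> charts_at M p \<Longrightarrow>
     ((\<lambda>x. V (cinv s x) c) has_derivative comp_deriv s c V p) (at (cmap s p))"
  unfolding differentiable_along_def by (simp add: differentiable_has_derivative)

lemma smooth_vf_along_differentiable:
  assumes V: "smooth_vf_along M S V" and s: "s \<in> charts_at S p"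
  shows "differentiable_along s V p"
  unfolding differentiable_along_def
proof (intro conjI ballI)
  show "\<exists>U. openin (mtop S) U \<and> p \<in> U \<and> (\<forall>q\<in>U. V q \<in> tangent_space M q)"
    using V chart_S_pts[OF s] by (intro exI[of _ "pts S"]) (simp add: smooth_vf_along_def)
  fix c assume c: "c \<in> charts_at M p"
  have "smooth_on (cmap s ` (cdom s \<inter> cdom c)) (\<lambda>x. V (cinv s x) c)"
    using V s c by (simp add: smooth_vf_along_def)
  from smooth_on_has_derivative[OF this, of "cmap s p"] s c
  show "(\<lambda>x. V (cinv s x) c) differentiable (at (cmap s p))"
    by (auto simp: differentiable_def)
qed

lemma cov_along_chart:
  assumes s: "s \<in> charts_at S p" and c: "c \<in> charts_at M p" and \<xi>: "\<xi> \<in> tangent_space S p"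
    and V: "differentiable_along s V p"
  shows "cov_along M nab S V p \<xi> c =
    comp_deriv s c V p (\<xi> s) + nab (coord_vec M c (V p c)) p (incl S M p \<xi>) c"
proof -
  have "tderiv S p \<xi> (\<lambda>q. V q c) = comp_deriv s c V p (\<xi> s)"
    by (rule tderiv_chart[OF smooth_S s \<xi>])
      (use comp_has_derivative[OF V c] in \<open>simp add: o_def\<close>)
  then show ?thesis using c by (simp add: cov_along_def)
qed

lemma cov_along_cong:
  assumes p: "p \<in> pts S" and \<xi>: "\<xi> \<in> tangent_space S p" and V: "smooth_vf_along M S V"
    and W: "smooth_vf_along M S W" and eq: "\<And>q. q \<in> pts S \<Longrightarrow> V q = W q"
  shows "cov_along M nab S V p \<xi> = cov_along M nab S W p \<xi>"
proof
  fix c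
  obtain s where s: "s \<in> charts_at S p" using chart_exists[OF smooth_S p] by (metis charts_at_iff)
  note V' = smooth_vf_along_differentiable[OF V s] and W' = smooth_vf_along_differentiable[OF W s]
  show "cov_along M nab S V p \<xi> c = cov_along M nab S W p \<xi> c"
  proof (cases "c \<in> charts_at M p")
    case c: True
    have "comp_deriv s c V p = comp_deriv s c W p"
      by (rule frechet_derivative_eqI,
          rule chart_has_derivative_transform[OF smooth_S s _ openin_topspace p])
        (use comp_has_derivative[OF W' c] s chart_cinv[OF smooth_S] eq in auto)
    then show ?thesis by (simp add: cov_along_chart[OF s c \<xi>] V' W' eq[OF p])
  next
    case False
    then show ?thesis by (simp add: cov_along_def del: charts_at_iff)
  qed
qed

text \<open>Differentiating the relation between the components of \<open>V\<close> in two charts produces second derivatives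
  of the chart change. They cancel against those in the transformation law of the Christoffel symbols.\<close>

lemma cov_along_jac:
  assumes s: "s \<in> charts_at S p" and c: "c \<in> charts_at M p" and d: "d \<in> charts_at M p"
    and \<xi>: "\<xi> \<in> tangent_space S p" and V: "differentiable_along s V p"
  shows "cov_along M nab S V p \<xi> d = jac c d p (cov_along M nab S V p \<xi> c)"
proof -
  define X where "X = incl S M p \<xi>"
  define w where "w = V p c"
  have X: "X \<in> tangent_space M p" unfolding X_def by (rule incl_tangent[OF chart_S_pts[OF s] \<xi>])
  have at: "c \<in> atlas M" "d \<in> atlas M" "s \<in> atlas S" and pc: "p \<in> cdom c" "p \<in> cdom d" "p \<in> cdom s"
    using s c d by auto
  note M = smooth_M
  have O: "openin (mtop M) (cdom c \<inter> cdom d)"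
    by (rule openin_Int[OF chart_openin[OF M at(1)] chart_openin[OF M at(2)]])
  obtain U where U: "openin (mtop S) U" "p \<in> U" "\<And>q. q \<in> U \<Longrightarrow> V q \<in> tangent_space M q"
    using differentiable_alongD[OF V] by metis
  have Vp: "V p \<in> tangent_space M p" using U by simp
  let ?K = "\<lambda>b y. coord_vec M c b (cinv d y) d"
  let ?K' = "\<lambda>b. frechet_derivative (?K b) (at (cmap d p))"
  have K: "(?K b has_derivative ?K' b) (at (cmap d p))" for b
    by (rule smooth_on_has_derivative[OF smooth_vf_component(1)[OF M at(2) O _
            smooth_vf_subset[OF coord_vec_smooth[OF M at(1)]]]]) (use pc in auto)
  have K': "((\<lambda>x. coord_vec M c b (cinv s x) d) has_derivative (\<lambda>y. ?K' b (incl_jac s d p y))) (at (cmap s p))" for b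
    by (rule restrict_derivative[OF s d]) (use K in \<open>simp add: o_def\<close>)
  \<comment> \<open>the transformation law of the Christoffel symbols\<close>
  have nabK: "nab (coord_vec M c b) p X d = ?K' b (incl_jac s d p (\<xi> s))
      + nab (coord_vec M d (jac c d p b)) p X d" for b
  proof -
    have "nab (coord_vec M c b) p X d = ?K' b (X d) + nab (coord_vec M d (coord_vec M c b p d)) p X d"
      by (rule nab_chart[OF M affine at(2) O _ smooth_vf_subset[OF coord_vec_smooth[OF M at(1)]]])
        (use pc X in auto)
    then show ?thesis unfolding X_def incl_chart[OF s d \<xi>] coord_vec_jac[OF d] .
  qed
  have "((\<lambda>x. \<Sum>b\<in>Basis. (V (cinv s x) c \<bullet> b) *\<^sub>R coord_vec M c b (cinv s x) d) has_derivative
     (\<lambda>y. \<Sum>b\<in>Basis. (V (cinv s (cmap s p)) c \<bullet> b) *\<^sub>R ?K' b (incl_jac s d p y)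
        + (comp_deriv s c V p y \<bullet> b) *\<^sub>R coord_vec M c b (cinv s (cmap s p)) d)) (at (cmap s p))"
    by (intro has_derivative_sum has_derivative_scaleR has_derivative_inner_left K'
        comp_has_derivative[OF V c])
  then have "((\<lambda>x. V (cinv s x) d) has_derivative
     (\<lambda>y. \<Sum>b\<in>Basis. (V (cinv s (cmap s p)) c \<bullet> b) *\<^sub>R ?K' b (incl_jac s d p y)
        + (comp_deriv s c V p y \<bullet> b) *\<^sub>R coord_vec M c b (cinv s (cmap s p)) d)) (at (cmap s p))"
  proof (rule chart_has_derivative_transform[OF smooth_S s, where U = "U \<inter> (cdom s \<inter> cdom c)"])
    show "openin (mtop S) (U \<inter> (cdom s \<inter> cdom c))"
      using U(1) incl_overlap_open(1)[OF at(3,1)] by (rule openin_Int)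
    show "p \<in> U \<inter> (cdom s \<inter> cdom c)" using U pc by simp
    fix q assume q: "q \<in> U \<inter> (cdom s \<inter> cdom c)"
    then have "V q = (\<Sum>b\<in>Basis. (V q c \<bullet> b) \<odot> coord_vec M c b q)"
      using U(3) at by (intro tangent_frame[OF M]) auto
    then have "V q d = (\<Sum>b\<in>Basis. (V q c \<bullet> b) \<odot> coord_vec M c b q) d" by (rule arg_cong)
    moreover have "cinv s (cmap s q) = q" using q at by (intro chart_cinv[OF smooth_S]) auto
    ultimately show "(\<Sum>b\<in>Basis. (V (cinv s (cmap s q)) c \<bullet> b) *\<^sub>R coord_vec M c b (cinv s (cmap s q)) d)
        = V (cinv s (cmap s q)) d" by (simp only: sum_tvec_apply tscale_def)
  qed
  from fun_cong[OF frechet_derivative_eqI[OF this], of "\<xi> s"]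
  have "comp_deriv s d V p (\<xi> s) = (\<Sum>b\<in>Basis. (w \<bullet> b) *\<^sub>R ?K' b (incl_jac s d p (\<xi> s))
        + (comp_deriv s c V p (\<xi> s) \<bullet> b) *\<^sub>R jac c d p b)"
    by (simp add: chart_cinv[OF smooth_S at(3) pc(3)] coord_vec_jac[OF d] w_def)
  also have "\<dots> = (\<Sum>b\<in>Basis. (w \<bullet> b) *\<^sub>R nab (coord_vec M c b) p X d)
      - (\<Sum>b\<in>Basis. (w \<bullet> b) *\<^sub>R nab (coord_vec M d (jac c d p b)) p X d)
      + (\<Sum>b\<in>Basis. (comp_deriv s c V p (\<xi> s) \<bullet> b) *\<^sub>R jac c d p b)"
    by (simp add: nabK sum.distrib scaleR_add_right)
  also have "\<dots> = nab (coord_vec M c w) p X d - nab (coord_vec M d (jac c d p w)) p X d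
      + jac c d p (comp_deriv s c V p (\<xi> s))"
    using linear_basis_expansion[OF nab_coord_vec_linear[OF M affine c X, of d], of w]
      linear_basis_expansion[OF jac_linear[OF M c d]]
      linear_basis_expansion[OF linear_compose[OF jac_linear[OF M c d] nab_coord_vec_linear[OF M affine d X, of d]], of w]
    by (simp add: o_def)
  finally have 1: "comp_deriv s d V p (\<xi> s) = nab (coord_vec M c w) p X d - nab (coord_vec M d (V p d)) p X d
      + jac c d p (comp_deriv s c V p (\<xi> s))"
    using tangent_spaceD(1)[OF Vp c d] by (simp add: w_def)
  have 2: "nab (coord_vec M c w) p X d = jac c d p (nab (coord_vec M c w) p X c)"
    by (rule tangent_spaceD(1)[OF nab_tangent[OF affine chart_openin[OF M at(1)] coord_vec_smooth[OF M at(1)] pc(1) X] c d])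
  show ?thesis
    unfolding cov_along_chart[OF s c \<xi> V] cov_along_chart[OF s d \<xi> V] linear_add[OF jac_linear[OF M c d]]
    using 1 2 by (simp add: X_def w_def)
qed

lemma cov_along_tangent:
  assumes s: "s \<in> charts_at S p" and \<xi>: "\<xi> \<in> tangent_space S p" and V: "differentiable_along s V p"
  shows "cov_along M nab S V p \<xi> \<in> tangent_space M p"
  by (rule tangent_spaceI) (rule cov_along_jac[OF s _ _ \<xi> V], assumption+,
      simp add: cov_along_def del: charts_at_iff)

lemma cov_along_frame:
  assumes s: "s \<in> charts_at S p" and c: "c \<in> charts_at M p" and \<xi>: "\<xi> \<in> tangent_space S p"
    and V: "differentiable_along s V p"
  shows "cov_along M nab S V p \<xi> = (\<Sum>b\<in>Basis. (comp_deriv s c V p (\<xi> s) \<bullet> b) \<odot> coord_vec M c b p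
     + (V p c \<bullet> b) \<odot> nab (coord_vec M c b) p (incl S M p \<xi>))"
proof (rule tangent_space_eqI[OF cov_along_tangent[OF s \<xi> V] _ c])
  note X = incl_tangent[OF chart_S_pts[OF s] \<xi>]
  note n = nab_tangent[OF affine chart_openin[OF smooth_M] coord_vec_smooth[OF smooth_M] _ X]
  show "(\<Sum>b\<in>Basis. (comp_deriv s c V p (\<xi> s) \<bullet> b) \<odot> coord_vec M c b p
     + (V p c \<bullet> b) \<odot> nab (coord_vec M c b) p (incl S M p \<xi>)) \<in> tangent_space M p"
    by (intro tangent_space_sum[OF smooth_M] tangent_space_add[OF smooth_M]
        tangent_space_scale[OF smooth_M] coord_vec_tangent[OF smooth_M c] n) (use c in auto)
  show "cov_along M nab S V p \<xi> c = (\<Sum>b\<in>Basis. (comp_deriv s c V p (\<xi> s) \<bullet> b) \<odot> coord_vec M c b p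
     + (V p c \<bullet> b) \<odot> nab (coord_vec M c b) p (incl S M p \<xi>)) c"
    by (simp add: cov_along_chart[OF s c \<xi> V] sum_tvec_apply sum.distrib coord_vec_chart[OF smooth_M c]
        euclidean_representation linear_basis_expansion[OF nab_coord_vec_linear[OF smooth_M affine c X]])
qed

text \<open>Both fields are expanded in the coordinate frame of one chart of \<open>M\<close>. The coefficients are handled by
  the product rule for functions, the metric on the frame by the compatibility of the connection
  with the metric.\<close>

lemma metric_along:
  assumes s: "s \<in> charts_at S p" and \<xi>: "\<xi> \<in> tangent_space S p"
    and V: "differentiable_along s V p" and W: "differentiable_along s W p"
  shows "\<exists>h'. ((\<lambda>x. g (cinv s x) (V (cinv s x)) (W (cinv s x))) has_derivative h') (at (cmap s p)) \<and>
    h' (\<xi> s) = g p (cov_along M nab S V p \<xi>) (W p) + g p (V p) (cov_along M nab S W p \<xi>)"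
proof -
  note M = smooth_M
  have p: "p \<in> pts S" "p \<in> pts M" using chart_S_pts[OF s] pts_S_M by auto
  obtain c where c: "c \<in> charts_at M p"
    using chart_exists[OF smooth_M p(2)] by (metis charts_at_iff)
  have at: "c \<in> atlas M" "s \<in> atlas S" and pc: "p \<in> cdom c" "p \<in> cdom s"
    using s c by auto
  define X where "X = incl S M p \<xi>"
  have X: "X \<in> tangent_space M p" unfolding X_def by (rule incl_tangent[OF p(1) \<xi>])
  note Oc = chart_openin[OF M at(1)] and E = coord_vec_smooth[OF M at(1)]
  let ?E = "\<lambda>b q. coord_vec M c b q"
  let ?n = "\<lambda>b. nab (?E b) p X"
  have n: "?n b \<in> tangent_space M p" for b using nab_tangent[OF affine Oc E pc(1) X] .
  have Ep: "?E b p \<in> tangent_space M p" for b using coord_vec_tangent[OF M c] .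
  let ?H = "\<lambda>b b' q. g q (?E b q) (?E b' q)"
  let ?H' = "\<lambda>b b'. frechet_derivative (?H b b' \<circ> cinv c) (at (cmap c p))"
  have H1: "(?H b b' \<circ> cinv c has_derivative ?H' b b') (at (cmap c p))" for b b'
  proof (rule smooth_on_has_derivative)
    show "smooth_on (cmap c ` (cdom c \<inter> cdom c)) (?H b b' \<circ> cinv c)"
      using metric_smooth[OF riem Oc E E] at(1) by (simp only: smooth_fun_def)
  qed (use pc in auto)
  have H2: "?H' b b' (incl_jac s c p (\<xi> s)) = g p (?n b) (?E b' p) + g p (?E b p) (?n b')" for b b'
  proof -
    have Xc: "?E (X c) p = X" using tangent_eq_coord_vec[OF M c X] by simp
    have "tderiv M p X (?H b b') = g p (?n b) (?E b' p) + g p (?E b p) (?n b')"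
      using levi_civita_metric[OF lc Oc E E E pc(1), of "X c" b b'] unfolding Xc .
    moreover have "tderiv M p X (?H b b') = ?H' b b' (X c)"
      by (rule tderiv_chart[OF M c X H1])
    ultimately show ?thesis unfolding X_def incl_chart[OF s c \<xi>] by simp
  qed
  obtain U1 where U1: "openin (mtop S) U1" "p \<in> U1" "\<And>q. q \<in> U1 \<Longrightarrow> V q \<in> tangent_space M q"
    using differentiable_alongD[OF V] by metis
  obtain U2 where U2: "openin (mtop S) U2" "p \<in> U2" "\<And>q. q \<in> U2 \<Longrightarrow> W q \<in> tangent_space M q"
    using differentiable_alongD[OF W] by metis
  have frame: "g q v w = (\<Sum>b\<in>Basis. \<Sum>b'\<in>Basis. (v c \<bullet> b) * ((w c \<bullet> b') * ?H b b' q))"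
    if "q \<in> cdom c" "v \<in> tangent_space M q" "w \<in> tangent_space M q" for q v w
  proof -
    have cq: "c \<in> charts_at M q" using that at by simp
    show ?thesis
      by (subst metric_frame_left[OF riem cq that(2,3)],
          subst metric_frame_right[OF riem cq coord_vec_tangent[OF M cq] that(3)])
        (simp add: sum_distrib_left)
  qed
  have cinv: "cinv s (cmap s q) = q" if "q \<in> cdom s" for q
    using that at by (intro chart_cinv[OF smooth_S]) auto
  let ?h' = "\<lambda>y. \<Sum>b\<in>Basis. \<Sum>b'\<in>Basis. (V p c \<bullet> b) * ((W p c \<bullet> b') * ?H' b b' (incl_jac s c p y)
      + (comp_deriv s c W p y \<bullet> b') * ?H b b' p) + (comp_deriv s c V p y \<bullet> b) * ((W p c \<bullet> b') * ?H b b' p)"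
  let ?h = "\<lambda>x. \<Sum>b\<in>Basis. \<Sum>b'\<in>Basis. (V (cinv s x) c \<bullet> b) * ((W (cinv s x) c \<bullet> b') * ?H b b' (cinv s x))"
  have "(?h has_derivative (\<lambda>y. \<Sum>b\<in>Basis. \<Sum>b'\<in>Basis.
      (V (cinv s (cmap s p)) c \<bullet> b) * ((W (cinv s (cmap s p)) c \<bullet> b') * ?H' b b' (incl_jac s c p y)
        + (comp_deriv s c W p y \<bullet> b') * ?H b b' (cinv s (cmap s p)))
      + (comp_deriv s c V p y \<bullet> b) * ((W (cinv s (cmap s p)) c \<bullet> b') * ?H b b' (cinv s (cmap s p))))) (at (cmap s p))"
    by (intro has_derivative_sum has_derivative_mult has_derivative_inner_left
        comp_has_derivative[OF V c] comp_has_derivative[OF W c] restrict_derivative[OF s c H1])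
  then have "(?h has_derivative ?h') (at (cmap s p))" using cinv[OF pc(2)] by simp
  then have D: "((\<lambda>x. g (cinv s x) (V (cinv s x)) (W (cinv s x))) has_derivative ?h') (at (cmap s p))"
  proof (rule chart_has_derivative_transform[OF smooth_S s, where U = "(U1 \<inter> U2) \<inter> (cdom s \<inter> cdom c)"])
    show "openin (mtop S) ((U1 \<inter> U2) \<inter> (cdom s \<inter> cdom c))"
      using U1(1) U2(1) incl_overlap_open(1)[OF at(2,1)] by (simp add: openin_Int)
    show "p \<in> (U1 \<inter> U2) \<inter> (cdom s \<inter> cdom c)" using U1 U2 pc by simp
    fix q assume "q \<in> (U1 \<inter> U2) \<inter> (cdom s \<inter> cdom c)"
    then show "?h (cmap s q) = g (cinv s (cmap s q)) (V (cinv s (cmap s q))) (W (cinv s (cmap s q)))"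
      using frame[of q "V q" "W q"] U1(3) U2(3) cinv by simp
  qed
  have T: "cov_along M nab S V p \<xi> \<in> tangent_space M p" "cov_along M nab S W p \<xi> \<in> tangent_space M p"
    "V p \<in> tangent_space M p" "W p \<in> tangent_space M p"
    using cov_along_tangent[OF s \<xi>] V W differentiable_along_tangent by auto
  have scaled: "r \<odot> ?E b p \<in> tangent_space M p" "r \<odot> ?n b \<in> tangent_space M p" for r b
    using tangent_space_scale[OF M] Ep n by auto
  have 1: "g p (cov_along M nab S V p \<xi>) u = (\<Sum>b\<in>Basis. (comp_deriv s c V p (\<xi> s) \<bullet> b) * g p (?E b p) u
      + (V p c \<bullet> b) * g p (?n b) u)" if u: "u \<in> tangent_space M p" for u
    unfolding cov_along_frame[OF s c \<xi> V] X_def[symmetric]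
    by (subst metric_sum_left[OF riem p(2) _ u], rule tangent_space_add[OF M scaled])
      (simp add: metric_add_left[OF riem p(2) scaled(1) u scaled(2)] metric_scale_left[OF riem p(2) Ep u]
        metric_scale_left[OF riem p(2) n u] del: plus_fun_apply)
  have 2: "g p u (cov_along M nab S W p \<xi>) = (\<Sum>b\<in>Basis. (comp_deriv s c W p (\<xi> s) \<bullet> b) * g p u (?E b p)
      + (W p c \<bullet> b) * g p u (?n b))" if u: "u \<in> tangent_space M p" for u
    unfolding cov_along_frame[OF s c \<xi> W] X_def[symmetric]
    by (subst metric_sum_right[OF riem p(2) _ u], rule tangent_space_add[OF M scaled])
      (simp add: metric_add_right[OF riem p(2) scaled(1) scaled(2) u] metric_scale_right[OF riem p(2) Ep u]
        metric_scale_right[OF riem p(2) n u] del: plus_fun_apply)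
  have "g p (cov_along M nab S V p \<xi>) (W p) = (\<Sum>b\<in>Basis. \<Sum>b'\<in>Basis.
      (comp_deriv s c V p (\<xi> s) \<bullet> b) * ((W p c \<bullet> b') * ?H b b' p)
      + (V p c \<bullet> b) * ((W p c \<bullet> b') * g p (?n b) (?E b' p)))"
    unfolding 1[OF T(4)] metric_frame_right[OF riem c Ep T(4)] metric_frame_right[OF riem c n T(4)]
    by (simp add: sum_distrib_left sum.distrib)
  moreover have "g p (V p) (cov_along M nab S W p \<xi>) = (\<Sum>b\<in>Basis. \<Sum>b'\<in>Basis.
      (V p c \<bullet> b) * ((comp_deriv s c W p (\<xi> s) \<bullet> b') * ?H b b' p + (W p c \<bullet> b') * g p (?E b p) (?n b')))"
    unfolding metric_frame_left[OF riem c T(3) T(2)] 2[OF Ep]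
    by (simp add: sum_distrib_left)
  ultimately have "?h' (\<xi> s) = g p (cov_along M nab S V p \<xi>) (W p) + g p (V p) (cov_along M nab S W p \<xi>)"
    by (simp add: H2 sum.distrib[symmetric] algebra_simps)
  with D show ?thesis by blast
qed

lemma metric_along_constant:
  assumes s: "s \<in> charts_at S p" and \<xi>: "\<xi> \<in> tangent_space S p"
    and V: "differentiable_along s V p" and W: "differentiable_along s W p"
    and U: "openin (mtop S) U" "p \<in> U" and const: "\<And>q. q \<in> U \<Longrightarrow> g q (V q) (W q) = k"
  shows "g p (cov_along M nab S V p \<xi>) (W p) + g p (V p) (cov_along M nab S W p \<xi>) = 0"
proof -
  let ?h = "\<lambda>x. g (cinv s x) (V (cinv s x)) (W (cinv s x))"
  obtain h' where h': "(?h has_derivative h') (at (cmap s p))"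
    "h' (\<xi> s) = g p (cov_along M nab S V p \<xi>) (W p) + g p (V p) (cov_along M nab S W p \<xi>)"
    using metric_along[OF s \<xi> V W] by blast
  have "(?h has_derivative (\<lambda>_. 0)) (at (cmap s p))"
    by (rule chart_has_derivative_transform[OF smooth_S s has_derivative_const[of k] U])
      (use s const chart_cinv[OF smooth_S, of s] in simp)
  from has_derivative_unique[OF h'(1) this] have "h' = (\<lambda>_. 0)" .
  then show ?thesis using h'(2) by simp
qed

end

section \<open>The second fundamental form\<close>

context immersed_hypersurface
begin

text \<open>In charts, the coordinate field of \<open>S\<close> in direction \<open>\<eta>\<close> is the derivative of the inclusion in direction
  \<open>\<eta>\<close>, so its derivative is a second derivative of the inclusion.\<close>

lemma coord_field_has_derivative:
  assumes s: "s \<in> charts_at S p" and c: "c \<in> charts_at M p"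
  shows "((\<lambda>x. incl S M (cinv s x) (coord_vec S s \<eta> (cinv s x)) c) has_derivative
    frechet_derivative (\<lambda>x. frechet_derivative (cmap c \<circ> cinv s) (at x) \<eta>) (at (cmap s p))) (at (cmap s p))"
proof (rule chart_has_derivative_transform[OF smooth_S s, where U = "cdom s \<inter> cdom c"])
  have at: "s \<in> atlas S" "c \<in> atlas M" and pc: "p \<in> cdom s" "p \<in> cdom c" using s c by auto
  show "openin (mtop S) (cdom s \<inter> cdom c)" using incl_overlap_open(1)[OF at] .
  show "p \<in> cdom s \<inter> cdom c" using pc by simp
  show "((\<lambda>x. frechet_derivative (cmap c \<circ> cinv s) (at x) \<eta>) has_derivative
     frechet_derivative (\<lambda>x. frechet_derivative (cmap c \<circ> cinv s) (at x) \<eta>) (at (cmap s p))) (at (cmap s p))"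
    by (rule smooth_on_has_derivative[OF smooth_on_frechet_derivative[OF incl_smooth[OF at]]])
      (use pc in auto)
  fix q assume q: "q \<in> cdom s \<inter> cdom c"
  then have qs: "s \<in> charts_at S q" "c \<in> charts_at M q" using at by auto
  have e: "cinv s (cmap s q) = q" using q at by (intro chart_cinv[OF smooth_S]) auto
  show "frechet_derivative (cmap c \<circ> cinv s) (at (cmap s q)) \<eta>
      = incl S M (cinv s (cmap s q)) (coord_vec S s \<eta> (cinv s (cmap s q))) c"
    unfolding e incl_chart[OF qs coord_vec_tangent[OF smooth_S qs(1)]] coord_vec_chart[OF smooth_S qs(1)] ..
qed

lemma coord_field_differentiable:
  assumes s: "s \<in> charts_at S p"
  shows "differentiable_along s (\<lambda>q. incl S M q (coord_vec S s \<eta> q)) p"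
  unfolding differentiable_along_def
proof (intro conjI ballI exI[of _ "cdom s"])
  have at: "s \<in> atlas S" using s by simp
  show "openin (mtop S) (cdom s)" using chart_openin[OF smooth_S at] .
  show "p \<in> cdom s" using s by simp
  fix q assume "q \<in> cdom s"
  then have "s \<in> charts_at S q" using at by simp
  then show "incl S M q (coord_vec S s \<eta> q) \<in> tangent_space M q"
    by (intro incl_tangent chart_S_pts coord_vec_tangent[OF smooth_S])
next
  fix c assume "c \<in> charts_at M p"
  then show "(\<lambda>x. incl S M (cinv s x) (coord_vec S s \<eta> (cinv s x)) c) differentiable (at (cmap s p))"
    using coord_field_has_derivative[OF s] unfolding differentiable_def by blast
qed

text \<open>In a chart both sides consist of a second derivative of the inclusion and a Christoffel term, and each of
  these is symmetric.\<close>

lemma cov_along_coord_field_symmetric: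
  assumes s: "s \<in> charts_at S p"
  shows "cov_along M nab S (\<lambda>q. incl S M q (coord_vec S s \<eta> q)) p (coord_vec S s \<xi> p) =
         cov_along M nab S (\<lambda>q. incl S M q (coord_vec S s \<xi> q)) p (coord_vec S s \<eta> p)"
proof -
  have p: "p \<in> pts S" using chart_S_pts[OF s] .
  obtain c where c: "c \<in> charts_at M p"
    using chart_exists[OF smooth_M pts_S_M[OF p]] by (metis charts_at_iff)
  have at: "s \<in> atlas S" "c \<in> atlas M" and pc: "p \<in> cdom s" "p \<in> cdom c" using s c by auto
  note T = coord_vec_tangent[OF smooth_S s] and D = coord_field_differentiable[OF s]
  let ?F = "cmap c \<circ> cinv s"
  have incl: "incl S M p (coord_vec S s \<eta> p) c = incl_jac s c p \<eta>"
    "incl S M p (coord_vec S s \<eta> p) = coord_vec M c (incl_jac s c p \<eta>) p" for \<eta>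
  proof -
    show 1: "incl S M p (coord_vec S s \<eta> p) c = incl_jac s c p \<eta>"
      using incl_chart[OF s c T[of \<eta>]] coord_vec_chart[OF smooth_S s] by simp
    show "incl S M p (coord_vec S s \<eta> p) = coord_vec M c (incl_jac s c p \<eta>) p"
      using tangent_eq_coord_vec[OF smooth_M c incl_tangent[OF p T[of \<eta>]]] unfolding 1 .
  qed
  have cov: "cov_along M nab S (\<lambda>q. incl S M q (coord_vec S s \<eta> q)) p (coord_vec S s \<xi> p) c =
     frechet_derivative (\<lambda>x. frechet_derivative ?F (at x) \<eta>) (at (cmap s p)) \<xi> +
     nab (coord_vec M c (incl_jac s c p \<eta>)) p (coord_vec M c (incl_jac s c p \<xi>) p) c" for \<eta> \<xi>
    unfolding cov_along_chart[OF s c T D] incl(1) coord_vec_chart[OF smooth_S s]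
      frechet_derivative_eqI[OF coord_field_has_derivative[OF s c]] unfolding incl(2) ..
  have sym: "frechet_derivative (\<lambda>x. frechet_derivative ?F (at x) \<eta>) (at (cmap s p)) \<xi> =
     frechet_derivative (\<lambda>x. frechet_derivative ?F (at x) \<xi>) (at (cmap s p)) \<eta>"
    by (rule symmetric_second_derivative[OF incl_overlap_open(2)[OF at] _ incl_smooth[OF at]])
      (use pc in auto)
  show ?thesis
    by (rule tangent_space_eqI[OF cov_along_tangent[OF s T D] cov_along_tangent[OF s T D] c])
      (simp only: cov sym nab_coord_vec_symmetric[OF smooth_M lc c])
qed

lemma nab_dir_linear:
  assumes c: "c \<in> charts_at M p" and U: "openin (mtop M) U" "smooth_vf M U Y" "p \<in> U"
  shows "linear (\<lambda>w. nab Y p (coord_vec M c w p) d)"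
proof (rule linearI)
  fix w z r
  note T = coord_vec_tangent[OF smooth_M c]
  show "nab Y p (coord_vec M c (w + z) p) d = nab Y p (coord_vec M c w p) d + nab Y p (coord_vec M c z p) d"
    by (simp only: coord_vec_add[OF smooth_M c] nab_add_dir[OF affine U T T] plus_fun_apply)
  show "nab Y p (coord_vec M c (r *\<^sub>R w) p) d = r *\<^sub>R nab Y p (coord_vec M c w p) d"
    by (simp only: coord_vec_scale[OF smooth_M c] nab_scale_dir[OF affine U T] tscale_apply)
qed

lemma cov_along_dir_linear:
  assumes s: "s \<in> charts_at S p" and V: "differentiable_along s V p"
    and \<xi>: "\<xi> \<in> tangent_space S p" and \<eta>: "\<eta> \<in> tangent_space S p"
  shows cov_along_add_dir:
      "cov_along M nab S V p (\<xi> + \<eta>) = cov_along M nab S V p \<xi> + cov_along M nab S V p \<eta>"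
    and cov_along_scale_dir: "cov_along M nab S V p (r \<odot> \<xi>) = r \<odot> cov_along M nab S V p \<xi>"
proof -
  have p: "p \<in> pts S" using chart_S_pts[OF s] .
  obtain c where c: "c \<in> charts_at M p"
    using chart_exists[OF smooth_M pts_S_M[OF p]] by (metis charts_at_iff)
  note L = has_derivative_linear[OF comp_has_derivative[OF V c]]
  have n: "openin (mtop M) (cdom c)" "smooth_vf M (cdom c) (coord_vec M c w)" "p \<in> cdom c" for w
    using c chart_openin[OF smooth_M] coord_vec_smooth[OF smooth_M] by auto
  note I = incl_tangent[OF p \<xi>] incl_tangent[OF p \<eta>]
  note 1 = tangent_space_add[OF smooth_S \<xi> \<eta>]
  show "cov_along M nab S V p (\<xi> + \<eta>) = cov_along M nab S V p \<xi> + cov_along M nab S V p \<eta>"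
  proof (rule tangent_space_eqI[OF cov_along_tangent[OF s 1 V]
          tangent_space_add[OF smooth_M cov_along_tangent[OF s \<xi> V] cov_along_tangent[OF s \<eta> V]] c])
    show "cov_along M nab S V p (\<xi> + \<eta>) c = (cov_along M nab S V p \<xi> + cov_along M nab S V p \<eta>) c"
      unfolding plus_fun_apply cov_along_chart[OF s c 1 V] cov_along_chart[OF s c \<xi> V]
        cov_along_chart[OF s c \<eta> V] incl_add[OF p \<xi> \<eta>] nab_add_dir[OF affine n I(1) I(2)] linear_add[OF L]
      by simp
  qed
  note 2 = tangent_space_scale[OF smooth_S \<xi>, of r]
  show "cov_along M nab S V p (r \<odot> \<xi>) = r \<odot> cov_along M nab S V p \<xi>"
  proof (rule tangent_space_eqI[OF cov_along_tangent[OF s 2 V]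
          tangent_space_scale[OF smooth_M cov_along_tangent[OF s \<xi> V]] c])
    show "cov_along M nab S V p (r \<odot> \<xi>) c = (r \<odot> cov_along M nab S V p \<xi>) c"
      unfolding tscale_apply cov_along_chart[OF s c 2 V] cov_along_chart[OF s c \<xi> V]
        incl_scale[OF p \<xi> \<xi>] nab_scale_dir[OF affine n I(1)] linear_scale[OF L]
      by (simp add: scaleR_add_right)
  qed
qed

end

locale normal_hypersurface = immersed_hypersurface M g nab S
  for M :: "('m, 'e::euclidean_space) mfd" and g nab and S :: "('m, 'f::euclidean_space) mfd" +
  fixes N :: "'m \<Rightarrow> ('m, 'e) tvec"
  assumes normal: "unit_normal M g S N"
begin

lemma N_differentiable: "s \<in> charts_at S p \<Longrightarrow> differentiable_along s N p"
  using normal by (intro smooth_vf_along_differentiable) (simp_all add: unit_normal_def)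

lemma N_tangent: "p \<in> pts S \<Longrightarrow> N p \<in> tangent_space M p"
  using normal by (simp add: unit_normal_def smooth_vf_along_def)

lemma N_unit: "p \<in> pts S \<Longrightarrow> g p (N p) (N p) = 1"
  using normal by (simp add: unit_normal_def)

lemma N_orthogonal: "p \<in> pts S \<Longrightarrow> \<xi> \<in> tangent_space S p \<Longrightarrow> g p (N p) (incl S M p \<xi>) = 0"
  using normal by (simp add: unit_normal_def)

lemma S_chart:
  assumes "p \<in> pts S" obtains s where "s \<in> charts_at S p"
  using chart_exists[OF smooth_S assms] by (metis charts_at_iff)

lemma cov_N_tangent:
  assumes "p \<in> pts S" "\<xi> \<in> tangent_space S p"
  shows "cov_along M nab S N p \<xi> \<in> tangent_space M p"
proof -
  obtain s where s: "s \<in> charts_at S p" using S_chart[OF assms(1)] .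
  show ?thesis by (rule cov_along_tangent[OF s assms(2) N_differentiable[OF s]])
qed

lemma cov_N_orthogonal:
  assumes p: "p \<in> pts S" and \<xi>: "\<xi> \<in> tangent_space S p"
  shows "g p (cov_along M nab S N p \<xi>) (N p) = 0"
proof -
  obtain s where s: "s \<in> charts_at S p" using S_chart[OF p] .
  have "g p (cov_along M nab S N p \<xi>) (N p) + g p (N p) (cov_along M nab S N p \<xi>) = 0"
    by (rule metric_along_constant[OF s \<xi> N_differentiable[OF s] N_differentiable[OF s],
          of "pts S", OF openin_topspace p N_unit])
  then show ?thesis
    using metric_sym[OF riem pts_S_M[OF p] N_tangent[OF p] cov_N_tangent[OF p \<xi>]] by simp
qed

text \<open>Coordinate fields \<open>Y\<close> of \<open>S\<close> satisfy \<open>\<langle>N, Y\<rangle> = 0\<close>. Differentiating this equation moves the derivative from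
  \<open>N\<close> to \<open>Y\<close>, where the symmetry is known.\<close>

lemma second_fundamental_form_symmetric:
  assumes p: "p \<in> pts S" and \<xi>: "\<xi> \<in> tangent_space S p" and \<eta>: "\<eta> \<in> tangent_space S p"
  shows "g p (cov_along M nab S N p \<xi>) (incl S M p \<eta>) = g p (cov_along M nab S N p \<eta>) (incl S M p \<xi>)"
proof -
  obtain s where s: "s \<in> charts_at S p" using S_chart[OF p] .
  have at: "s \<in> atlas S" "p \<in> cdom s" using s by auto
  let ?Y = "\<lambda>\<eta> q. incl S M q (coord_vec S s (\<eta> s) q)"
  have coord: "coord_vec S s (\<xi> s) p = \<xi>" if "\<xi> \<in> tangent_space S p" for \<xi>
    using tangent_eq_coord_vec[OF smooth_S s that] by simp
  have *: "g p (cov_along M nab S N p \<xi>) (incl S M p \<eta>) = - g p (N p) (cov_along M nab S (?Y \<eta>) p \<xi>)"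
    if \<xi>: "\<xi> \<in> tangent_space S p" and \<eta>: "\<eta> \<in> tangent_space S p" for \<xi> \<eta>
  proof -
    have "g p (cov_along M nab S N p \<xi>) (?Y \<eta> p) + g p (N p) (cov_along M nab S (?Y \<eta>) p \<xi>) = 0"
    proof (rule metric_along_constant[OF s \<xi> N_differentiable[OF s] coord_field_differentiable[OF s]
          chart_openin[OF smooth_S at(1)] at(2)])
      fix q assume "q \<in> cdom s"
      then have q: "s \<in> charts_at S q" using at by simp
      show "g q (N q) (incl S M q (coord_vec S s (\<eta> s) q)) = 0"
        by (rule N_orthogonal[OF chart_S_pts[OF q] coord_vec_tangent[OF smooth_S q]])
    qed
    then show ?thesis unfolding coord[OF \<eta>] by simp
  qed
  have "cov_along M nab S (?Y \<eta>) p \<xi> = cov_along M nab S (?Y \<xi>) p \<eta>"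
    using cov_along_coord_field_symmetric[OF s, of "\<eta> s" "\<xi> s"] unfolding coord[OF \<xi>] coord[OF \<eta>] .
  then show ?thesis using *[OF \<xi> \<eta>] *[OF \<eta> \<xi>] by simp
qed

text \<open>A dimension count: the image of the differential of the inclusion has codimension one and lies in the
  orthogonal complement of \<open>N\<close>, a proper subspace because \<open>N\<close> is not orthogonal to itself.\<close>

lemma orthogonal_to_normal_is_tangent:
  assumes p: "p \<in> pts S" and u: "u \<in> tangent_space M p" and orth: "g p u (N p) = 0"
  obtains \<xi> where "\<xi> \<in> tangent_space S p" "incl S M p \<xi> = u"
proof -
  obtain s where s: "s \<in> charts_at S p" using S_chart[OF p] .
  have pM: "p \<in> pts M" using pts_S_M[OF p] .
  obtain c where c: "c \<in> charts_at M p" using chart_exists[OF smooth_M pM] by (metis charts_at_iff)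
  let ?J = "incl_jac s c p"
  let ?H = "{v. g p (coord_vec M c v p) (N p) = 0}"
  note T = coord_vec_tangent[OF smooth_M c] and TS = coord_vec_tangent[OF smooth_S s]
  have J: "linear ?J" by (rule has_derivative_linear[OF incl_has_derivative[OF s c]])
  have incl: "incl S M p (coord_vec S s y p) = coord_vec M c (?J y) p" for y
    using tangent_eq_coord_vec[OF smooth_M c incl_tangent[OF p TS[of y]]]
    unfolding incl_chart[OF s c TS] coord_vec_chart[OF smooth_S s] .
  have "inj ?J"
  proof (rule injI)
    fix y z assume "?J y = ?J z"
    then have "incl S M p (coord_vec S s y p) = incl S M p (coord_vec S s z p)" by (simp only: incl)
    then have "coord_vec S s y p = coord_vec S s z p" by (rule incl_inject[OF p TS TS])
    then show "y = z" using coord_vec_chart[OF smooth_S s] by metis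
  qed
  then have dim_J: "dim (range ?J) = DIM('f)"
    using dim_image_eq[OF J, of UNIV] by simp
  have H: "subspace ?H"
  proof (rule subspaceI)
    show "0 \<in> ?H" using coord_vec_scale[OF smooth_M c, of 0 0] metric_zero_left[OF riem pM N_tangent[OF p]]
      by (simp del: zero_fun_apply)
    show "v + w \<in> ?H" if "v \<in> ?H" "w \<in> ?H" for v w
      using that by (simp add: coord_vec_add[OF smooth_M c] metric_add_left[OF riem pM T N_tangent[OF p] T]
          del: plus_fun_apply)
    show "r *\<^sub>R v \<in> ?H" if "v \<in> ?H" for r v
      using that by (simp add: coord_vec_scale[OF smooth_M c] metric_scale_left[OF riem pM T N_tangent[OF p]])
  qed
  have sub: "range ?J \<subseteq> ?H"
    using N_orthogonal[OF p TS] metric_sym[OF riem pM N_tangent[OF p] incl_tangent[OF p TS]]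
    by (auto simp: incl)
  have "g p (coord_vec M c (N p c) p) (N p) = 1"
    using N_unit[OF p] tangent_eq_coord_vec[OF smooth_M c N_tangent[OF p]] by simp
  then have "N p c \<notin> ?H" by simp
  then have "?H \<noteq> UNIV" by (metis UNIV_I)
  then have "dim ?H \<noteq> DIM('e)" using H dim_eq_full[of ?H] span_eq_iff[of ?H] by metis
  \<comment> \<open>here the codimension of \<open>S\<close> enters\<close>
  then have "dim ?H \<le> DIM('f)"
    using dim_subset_UNIV[of ?H] hyp by (auto simp: hypersurface_def)
  then have "range ?J = ?H"
    using subspace_dim_equal[OF linear_subspace_image[OF J subspace_UNIV] H sub] dim_J by simp
  moreover have "u c \<in> ?H" using orth tangent_eq_coord_vec[OF smooth_M c u] by simp
  ultimately obtain y where y: "u c = ?J y" by blast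
  have "incl S M p (coord_vec S s y p) = u"
    unfolding incl y[symmetric] using tangent_eq_coord_vec[OF smooth_M c u] by simp
  then show ?thesis using that TS by blast
qed

lemma shape_operator_eqI:
  assumes "p \<in> pts S" "\<eta> \<in> tangent_space S p" "incl S M p \<eta> = - cov_along M nab S N p \<xi>"
  shows "shape_operator M nab S N p \<xi> = \<eta>"
  unfolding shape_operator_def
proof (rule the_equality)
  show "\<eta> \<in> tangent_space S p \<and> incl S M p \<eta> = - cov_along M nab S N p \<xi>" using assms by simp
  fix \<zeta> assume "\<zeta> \<in> tangent_space S p \<and> incl S M p \<zeta> = - cov_along M nab S N p \<xi>"
  then show "\<zeta> = \<eta>" using incl_inject[OF assms(1), of \<zeta> \<eta>] assms(2,3) by simp
qed

lemma shape_operator_tangent: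
  assumes p: "p \<in> pts S" and \<xi>: "\<xi> \<in> tangent_space S p"
  shows "shape_operator M nab S N p \<xi> \<in> tangent_space S p"
    and "incl S M p (shape_operator M nab S N p \<xi>) = - cov_along M nab S N p \<xi>"
proof -
  let ?D = "cov_along M nab S N p \<xi>"
  have D: "?D \<in> tangent_space M p" by (rule cov_N_tangent[OF p \<xi>])
  have "g p (- ?D) (N p) = 0"
    unfolding tscale_minus_one[of ?D] metric_scale_left[OF riem pts_S_M[OF p] D N_tangent[OF p]]
      cov_N_orthogonal[OF p \<xi>] by simp
  then obtain \<eta> where \<eta>: "\<eta> \<in> tangent_space S p" "incl S M p \<eta> = - ?D"
    using orthogonal_to_normal_is_tangent[OF p tangent_space_uminus[OF smooth_M D]] by metis
  then have "shape_operator M nab S N p \<xi> = \<eta>" by (intro shape_operator_eqI[OF p])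
  then show "shape_operator M nab S N p \<xi> \<in> tangent_space S p"
    "incl S M p (shape_operator M nab S N p \<xi>) = - ?D" using \<eta> by simp_all
qed

lemma shape_operator_linear:
  assumes s: "s \<in> charts_at S p"
  shows "linear (\<lambda>w. shape_operator M nab S N p (coord_vec S s w p) s)"
proof (rule linearI)
  fix w z r
  have p: "p \<in> pts S" using chart_S_pts[OF s] .
  let ?A = "shape_operator M nab S N p"
  note T = coord_vec_tangent[OF smooth_S s] and N = N_differentiable[OF s]
  note A = shape_operator_tangent[OF p T]
  have "?A (coord_vec S s (w + z) p) = ?A (coord_vec S s w p) + ?A (coord_vec S s z p)"
    by (rule shape_operator_eqI[OF p tangent_space_add[OF smooth_S A(1) A(1)]])
      (simp add: incl_add[OF p A(1) A(1)] A(2) coord_vec_add[OF smooth_S s] cov_along_add_dir[OF s N T T]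
        del: plus_fun_apply)
  then show "?A (coord_vec S s (w + z) p) s = ?A (coord_vec S s w p) s + ?A (coord_vec S s z p) s" by simp
  have "?A (coord_vec S s (r *\<^sub>R w) p) = r \<odot> ?A (coord_vec S s w p)"
    by (rule shape_operator_eqI[OF p tangent_space_scale[OF smooth_S A(1)]])
      (simp add: incl_scale[OF p A(1) A(1)] A(2) coord_vec_scale[OF smooth_S s] cov_along_scale_dir[OF s N T T]
        fun_eq_iff)
  then show "?A (coord_vec S s (r *\<^sub>R w) p) s = r *\<^sub>R ?A (coord_vec S s w p) s" by simp
qed

end

lemma endo_det_eq_0:
  fixes S :: "('m, real^'n) mfd"
  assumes S: "smooth_manifold S" and p: "p \<in> pts S"
    and L: "\<And>s. s \<in> charts_at S p \<Longrightarrow> linear (\<lambda>w. L (coord_vec S s w p) s)"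
    and \<xi>: "\<xi> \<in> tangent_space S p" "\<xi> \<noteq> 0" "L \<xi> = 0"
  shows "endo_det S p L = 0"
proof -
  define s where "s = (SOME s. s \<in> charts_at S p)"
  have s: "s \<in> charts_at S p" unfolding s_def
    using chart_exists[OF S p] by (metis charts_at_iff someI)
  let ?f = "\<lambda>w. L (coord_vec S s w p) s"
  have "\<xi> s \<noteq> 0" using tangent_space_eqI[OF \<xi>(1) tangent_space_0[OF S] s] \<xi>(2) by auto
  moreover have "?f (\<xi> s) = 0" using tangent_eq_coord_vec[OF S s \<xi>(1)] \<xi>(3) by simp
  moreover have "?f 0 = 0" using linear_0[OF L[OF s]] .
  ultimately have "\<not> inj ?f" by (metis injD)
  then have "det (matrix ?f) = 0" using det_nz_iff_inj[OF L[OF s]] by blast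
  then show ?thesis unfolding endo_det_def s_def[symmetric] Let_def .
qed

section \<open>Solutions of quadratic second order equations are smooth\<close>

text \<open>Bootstrapping: if \<open>u\<close> and its derivative \<open>w\<close> are \<open>C^k\<close>, the equation for the derivative of \<open>w\<close> shows that
  both are \<open>C^(k+1)\<close>. The geodesic equation in a chart has this form.\<close>

lemma smooth_on_quadratic_ode:
  fixes u w :: "real \<Rightarrow> 'a::euclidean_space" and G :: "'a \<Rightarrow> 'a \<Rightarrow> 'a \<Rightarrow> 'a"
  assumes J: "open J" and O: "u ` J \<subseteq> T" and G: "\<And>b b'. smooth_on T (G b b')"
    and u: "\<And>t. t \<in> J \<Longrightarrow> (u has_vector_derivative w t) (at t)"
    and w: "\<And>t. t \<in> J \<Longrightarrow> (w has_vector_derivative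
      (\<Sum>b\<in>Basis. \<Sum>b'\<in>Basis. (w t \<bullet> b) *\<^sub>R (w t \<bullet> b') *\<^sub>R G b b' (u t))) (at t)"
  shows "smooth_on J u"
proof -
  have "Ck_on k J u \<and> Ck_on k J w" for k
  proof (induction k)
    case 0
    have "continuous_on J u" "continuous_on J w"
      by (rule continuous_at_imp_continuous_on, rule ballI, rule has_vector_derivative_continuous,
          erule u w)+
    then show ?case by simp
  next
    case (Suc k)
    then have Ck: "Ck_on k J u" "Ck_on k J w" by auto
    have "Ck_on (Suc k) J u"
      by (rule Ck_on_SucI[OF J u[unfolded has_vector_derivative_def]])
        (assumption, intro Ck_on_scaleR[OF J] Ck_on_const Ck)
    moreover have "Ck_on (Suc k) J w"
      by (rule Ck_on_SucI[OF J w[unfolded has_vector_derivative_def]])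
        (assumption, intro Ck_on_scaleR[OF J] Ck_on_const Ck_on_sum[OF J]
          Ck_on_bounded_linear[OF J bounded_linear_inner_left] Ck Ck_on_compose[OF J smooth_on_Ck[OF G] _ O])
    ultimately show ?case by blast
  qed
  then show ?thesis by (simp add: smooth_on_def)
qed

section \<open>Integral curves\<close>

lemma nab_smooth:
  assumes "affine_connection M nab" "openin (mtop M) U" "smooth_vf M U Y" "smooth_vf M U X"
  shows "smooth_vf M U (\<lambda>q. nab Y q (X q))"
  using assms(1)[unfolded affine_connection_def, THEN spec, THEN spec, THEN mp, OF conjI, OF assms(2,3)]
    assms(4) by (elim conjE) (drule spec, erule mp)

lemma integral_curve_preimage_open:
  assumes "integral_curve S X I \<gamma>" "openin (mtop S) W"
  shows "open {t \<in> I. \<gamma> t \<in> W}"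
proof -
  have "continuous_map (top_of_set I) (mtop S) \<gamma>" "open I"
    using assms(1) by (simp_all add: integral_curve_def)
  with openin_continuous_map_preimage[OF _ assms(2)] show ?thesis
    using openin_open_eq by fastforce
qed

lemma integral_curve_pts:
  assumes "integral_curve S X I \<gamma>" "t \<in> I" shows "\<gamma> t \<in> pts S"
proof -
  have "continuous_map (top_of_set I) (mtop S) \<gamma>" using assms(1) by (simp add: integral_curve_def)
  then show ?thesis using assms(2) by (auto simp: continuous_map_def)
qed

lemma integral_curve_chain:
  assumes S: "smooth_manifold S" and \<gamma>: "integral_curve S X I \<gamma>" and t: "t \<in> I"
    and s: "s \<in> charts_at S (\<gamma> t)"
    and h: "((\<lambda>x. h (cinv s x)) has_derivative h') (at (cmap s (\<gamma> t)))"
  shows "((\<lambda>\<tau>. h (\<gamma> \<tau>)) has_vector_derivative h' (X (\<gamma> t) s)) (at t)"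
proof -
  let ?J = "{\<tau> \<in> I. \<gamma> \<tau> \<in> cdom s}"
  have at: "s \<in> atlas S" using s by simp
  have J: "open ?J" using integral_curve_preimage_open[OF \<gamma> chart_openin[OF S at]] .
  have "((\<lambda>\<tau>. cmap s (\<gamma> \<tau>)) has_derivative (\<lambda>r. r *\<^sub>R X (\<gamma> t) s)) (at t)"
    using \<gamma> t s unfolding integral_curve_def has_vector_derivative_def by blast
  from has_derivative_compose[OF this h]
  have "((\<lambda>\<tau>. h (cinv s (cmap s (\<gamma> \<tau>)))) has_derivative (\<lambda>r. r *\<^sub>R h' (X (\<gamma> t) s))) (at t)"
    by (simp only: linear_scale[OF has_derivative_linear[OF h]])
  then have "((\<lambda>\<tau>. h (\<gamma> \<tau>)) has_derivative (\<lambda>r. r *\<^sub>R h' (X (\<gamma> t) s))) (at t)"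
    by (rule has_derivative_transform_within_open[OF _ J]) (use t s chart_cinv[OF S at] in auto)
  then show ?thesis by (simp add: has_vector_derivative_def)
qed

section \<open>Parallel fields of constant angle\<close>

locale parallel_constant_angle = normal_hypersurface M g nab S N
  for M :: "('m, 'e::euclidean_space) mfd" and g nab and S :: "('m, 'f::euclidean_space) mfd" and N +
  fixes V :: "'m \<Rightarrow> ('m, 'e) tvec" and k :: real
  assumes V_smooth: "smooth_vf_along M S V"
    and V_angle: "\<And>p. p \<in> pts S \<Longrightarrow> g p (V p) (N p) = k"
    and V_parallel: "parallel_along M nab S V"
begin

lemma V_differentiable: "s \<in> charts_at S p \<Longrightarrow> differentiable_along s V p"
  by (rule smooth_vf_along_differentiable[OF V_smooth])

lemma V_tangent: "p \<in> pts S \<Longrightarrow> V p \<in> tangent_space M p"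
  using V_smooth by (simp add: smooth_vf_along_def)

lemma cov_V:
  assumes p: "p \<in> pts S" and \<xi>: "\<xi> \<in> tangent_space S p"
  shows "cov_along M nab S V p \<xi> = 0"
proof -
  obtain X where "smooth_vf S (pts S) X" "X p = \<xi>" using extend_tangent_vector[OF smooth_S p \<xi>] .
  then show ?thesis using V_parallel p unfolding parallel_along_def by metis
qed

text \<open>The derivative of \<open>\<langle>V, N\<rangle> = k\<close>, in which the term with the derivative of \<open>V\<close> vanishes.\<close>

lemma V_cov_N:
  assumes p: "p \<in> pts S" and \<xi>: "\<xi> \<in> tangent_space S p"
  shows "g p (V p) (cov_along M nab S N p \<xi>) = 0"
proof -
  obtain s where s: "s \<in> charts_at S p" using S_chart[OF p] .
  have "g p (cov_along M nab S V p \<xi>) (N p) + g p (V p) (cov_along M nab S N p \<xi>) = 0"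
    by (rule metric_along_constant[OF s \<xi> V_differentiable[OF s] N_differentiable[OF s],
          of "pts S", OF openin_topspace p V_angle])
  then show ?thesis
    using cov_V[OF p \<xi>] metric_zero_left[OF riem pts_S_M[OF p] N_tangent[OF p]] by simp
qed

lemma tangential_part_exists:
  assumes p: "p \<in> pts S"
  obtains \<tau> where "\<tau> \<in> tangent_space S p" "incl S M p \<tau> = V p - k \<odot> N p"
proof -
  note T = V_tangent[OF p] N_tangent[OF p] tangent_space_scale[OF smooth_M N_tangent[OF p], of k]
  have "g p (V p - k \<odot> N p) (N p) = 0"
    unfolding metric_diff_left[OF riem pts_S_M[OF p] T(1,3,2)] metric_scale_left[OF riem pts_S_M[OF p] T(2,2)]
    by (simp add: N_unit[OF p] V_angle[OF p])
  with orthogonal_to_normal_is_tangent[OF p tangent_space_diff[OF smooth_M T(1,3)]] that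
  show ?thesis by metis
qed

text \<open>By the symmetry of the second fundamental form, \<open>\<langle>\<nabla>\<^sub>\<tau> N, X\<rangle> = \<langle>\<nabla>\<^sub>X N, \<tau>\<rangle> = \<langle>\<nabla>\<^sub>X N, V\<rangle> - k \<langle>\<nabla>\<^sub>X N, N\<rangle> = 0\<close>
  for every tangent vector \<open>X\<close>, and \<open>\<nabla>\<^sub>\<tau> N\<close> is itself tangent.\<close>

lemma cov_N_tangential_part:
  assumes p: "p \<in> pts S" and \<tau>: "\<tau> \<in> tangent_space S p" and incl: "incl S M p \<tau> = V p - k \<odot> N p"
  shows "cov_along M nab S N p \<tau> = 0"
proof -
  note pM = pts_S_M[OF p]
  let ?D = "cov_along M nab S N p"
  note D = cov_N_tangent[OF p]
  note T = V_tangent[OF p] N_tangent[OF p] tangent_space_scale[OF smooth_M N_tangent[OF p], of k]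
  have *: "g p (?D \<tau>) (incl S M p \<xi>) = 0" if \<xi>: "\<xi> \<in> tangent_space S p" for \<xi>
  proof -
    have "g p (?D \<tau>) (incl S M p \<xi>) = g p (?D \<xi>) (V p - k \<odot> N p)"
      using second_fundamental_form_symmetric[OF p \<tau> \<xi>] by (simp only: incl)
    also have "\<dots> = g p (V p - k \<odot> N p) (?D \<xi>)"
      by (rule metric_sym[OF riem pM D[OF \<xi>] tangent_space_diff[OF smooth_M T(1,3)]])
    also have "\<dots> = g p (V p) (?D \<xi>) - k * g p (N p) (?D \<xi>)"
      by (simp only: metric_diff_left[OF riem pM T(1,3) D[OF \<xi>]] metric_scale_left[OF riem pM T(2) D[OF \<xi>]])
    also have "\<dots> = 0"
      using V_cov_N[OF p \<xi>] cov_N_orthogonal[OF p \<xi>] metric_sym[OF riem pM T(2) D[OF \<xi>]] by simp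
    finally show ?thesis .
  qed
  obtain \<zeta> where "\<zeta> \<in> tangent_space S p" "incl S M p \<zeta> = ?D \<tau>"
    using orthogonal_to_normal_is_tangent[OF p D[OF \<tau>] cov_N_orthogonal[OF p \<tau>]] .
  with *[of \<zeta>] have "g p (?D \<tau>) (?D \<tau>) = 0" by simp
  then show ?thesis by (rule metric_eq_0D[OF riem pM D[OF \<tau>]])
qed

lemma shape_operator_tangential_part:
  assumes "p \<in> pts S" "\<tau> \<in> tangent_space S p" "incl S M p \<tau> = V p - k \<odot> N p"
  shows "shape_operator M nab S N p \<tau> = 0"
  by (rule shape_operator_eqI[OF assms(1) tangent_space_0[OF smooth_S]])
    (simp add: incl_zero[OF assms(1)] cov_N_tangential_part[OF assms] del: zero_fun_apply)

text \<open>Unit vectors \<open>V\<close> and \<open>N\<close> with inner product \<open>1\<close> coincide, so the normal field is parallel.\<close>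

lemma parallel_normal_shape_operator:
  assumes unit: "\<And>p. p \<in> pts S \<Longrightarrow> g p (V p) (V p) = 1" and k: "k = 1"
    and p: "p \<in> pts S" and \<xi>: "\<xi> \<in> tangent_space S p"
  shows "shape_operator M nab S N p \<xi> = 0"
proof -
  have VN: "V p = N p" if p: "p \<in> pts S" for p
  proof -
    note pM = pts_S_M[OF p]
    note t = V_tangent[OF p] N_tangent[OF p]
    note t' = tangent_space_diff[OF smooth_M t]
    have "g p (V p - N p) (V p - N p) = g p (V p) (V p - N p) - g p (N p) (V p - N p)"
      by (rule metric_diff_left[OF riem pM t t'])
    also have "\<dots> = g p (V p - N p) (V p) - g p (V p - N p) (N p)"
      using metric_sym[OF riem pM] t t' by simp
    also have "\<dots> = g p (V p) (V p) - g p (N p) (V p) - (g p (V p) (N p) - g p (N p) (N p))"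
      by (simp only: metric_diff_left[OF riem pM t t(1)] metric_diff_left[OF riem pM t t(2)])
    also have "\<dots> = 0"
      using metric_sym[OF riem pM t] unit[OF p] N_unit[OF p] V_angle[OF p] k by simp
    finally have "V p - N p = 0" by (rule metric_eq_0D[OF riem pM t'])
    then show ?thesis by (simp only: right_minus_eq)
  qed
  have "smooth_vf_along M S N" using normal by (simp add: unit_normal_def)
  then have "cov_along M nab S N p \<xi> = 0"
    using cov_along_cong[OF p \<xi> V_smooth _ VN] cov_V[OF p \<xi>] by metis
  then show ?thesis
    by (intro shape_operator_eqI[OF p tangent_space_0[OF smooth_S]])
      (simp add: incl_zero[OF p] del: zero_fun_apply)
qed

text \<open>The velocity of the curve in \<open>M\<close> is the restriction of \<open>V - k N\<close>, whose covariant derivative in the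
  direction of the velocity vanishes. Since \<open>V - k N\<close> has differentiable components, the curve is twice
  differentiable, which makes the geodesic equation available for the smoothness of the curve.\<close>

lemma integral_curve_geodesic:
  assumes X: "\<And>p. p \<in> pts S \<Longrightarrow> X p \<in> tangent_space S p"
    and incl: "\<And>p. p \<in> pts S \<Longrightarrow> incl S M p (X p) = V p - k \<odot> N p"
    and \<gamma>: "integral_curve S X I \<gamma>"
  shows "geodesic M nab I \<gamma>"
proof -
  have \<gamma>S: "\<gamma> t \<in> pts S" if "t \<in> I" for t using integral_curve_pts[OF \<gamma> that] .
  have S_M: "continuous_map (mtop S) (mtop M) (\<lambda>p. p)" using hyp by (simp add: hypersurface_def)
  have I: "open I" "is_interval I" "continuous_map (top_of_set I) (mtop S) \<gamma>"
    using \<gamma> by (simp_all add: integral_curve_def)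
  have \<gamma>M: "continuous_map (top_of_set I) (mtop M) \<gamma>"
    using continuous_map_compose[OF I(3) S_M] by (simp add: o_def)
  let ?W = "\<lambda>q. V q - k \<odot> N q"
  have W: "?W p \<in> tangent_space M p" if "p \<in> pts S" for p
    using incl_tangent[OF that X[OF that]] incl[OF that] by simp
  have deriv: "((\<lambda>\<tau>. cmap c (\<gamma> \<tau>)) has_vector_derivative ?W (\<gamma> t) c) (at t)"
    if t: "t \<in> I" and c: "c \<in> charts_at M (\<gamma> t)" for t c
  proof -
    obtain s where s: "s \<in> charts_at S (\<gamma> t)" using S_chart[OF \<gamma>S[OF t]] .
    have "((\<lambda>\<tau>. cmap c (\<gamma> \<tau>)) has_vector_derivative incl_jac s c (\<gamma> t) (X (\<gamma> t) s)) (at t)"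
      by (rule integral_curve_chain[OF smooth_S \<gamma> t s]) (use incl_has_derivative[OF s c] in \<open>simp add: o_def\<close>)
    then show ?thesis using incl_chart[OF s c X[OF \<gamma>S[OF t]]] by (simp add: incl[OF \<gamma>S[OF t]])
  qed
  have velocity: "velocity M \<gamma> t = ?W (\<gamma> t)" if t: "t \<in> I" for t
  proof
    fix c show "velocity M \<gamma> t c = ?W (\<gamma> t) c"
    proof (cases "c \<in> charts_at M (\<gamma> t)")
      case True
      then show ?thesis using vector_derivative_at[OF deriv[OF t True]] by (simp add: velocity_def)
    next
      case False
      then show ?thesis using tangent_spaceD(2)[OF W[OF \<gamma>S[OF t]] False]
        by (simp add: velocity_def del: charts_at_iff)
    qed
  qed
  have deriv2: "((\<lambda>\<tau>. velocity M \<gamma> \<tau> c) has_vector_derivative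
      - nab (coord_vec M c (?W (\<gamma> t) c)) (\<gamma> t) (?W (\<gamma> t)) c) (at t)"
    if t: "t \<in> I" and c: "c \<in> charts_at M (\<gamma> t)" for t c
  proof -
    let ?p = "\<gamma> t"
    note p = \<gamma>S[OF t]
    obtain s where s: "s \<in> charts_at S ?p" using S_chart[OF p] .
    note D = V_differentiable[OF s] N_differentiable[OF s]
    let ?DV = "comp_deriv s c V ?p" and ?DN = "comp_deriv s c N ?p"
    have "((\<lambda>\<tau>. ?W (\<gamma> \<tau>) c) has_vector_derivative ?DV (X ?p s) - k *\<^sub>R ?DN (X ?p s)) (at t)"
      by (rule integral_curve_chain[OF smooth_S \<gamma> t s])
        (simp, intro has_derivative_diff has_derivative_scaleR_right comp_has_derivative[OF _ c] D)
    then have 1: "((\<lambda>\<tau>. velocity M \<gamma> \<tau> c) has_vector_derivative ?DV (X ?p s) - k *\<^sub>R ?DN (X ?p s)) (at t)"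
      by (rule has_vector_derivative_transform_within_open[OF _ I(1) t]) (simp add: velocity)
    note L = nab_coord_vec_linear[OF smooth_M affine c W[OF p], of c]
    have "?DV (X ?p s) = - nab (coord_vec M c (V ?p c)) ?p (?W ?p) c"
      using cov_along_chart[OF s c X[OF p] D(1)] cov_V[OF p X[OF p]]
      by (simp add: incl[OF p] eq_neg_iff_add_eq_0)
    moreover have "?DN (X ?p s) = - nab (coord_vec M c (N ?p c)) ?p (?W ?p) c"
      using cov_along_chart[OF s c X[OF p] D(2)] cov_N_tangential_part[OF p X[OF p] incl[OF p]]
      by (simp add: incl[OF p] eq_neg_iff_add_eq_0)
    moreover have "nab (coord_vec M c (?W ?p c)) ?p (?W ?p) c =
      nab (coord_vec M c (V ?p c)) ?p (?W ?p) c - k *\<^sub>R nab (coord_vec M c (N ?p c)) ?p (?W ?p) c"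
      using linear_diff[OF L, of "V ?p c" "k *\<^sub>R N ?p c"] linear_scale[OF L, of k "N ?p c"] by simp
    ultimately show ?thesis using 1 by simp
  qed
  have "cov_curve M nab \<gamma> (velocity M \<gamma>) t = 0" if t: "t \<in> I" for t
  proof
    fix c show "cov_curve M nab \<gamma> (velocity M \<gamma>) t c = 0 c"
      using vector_derivative_at[OF deriv2[OF t, of c]]
      by (simp add: cov_curve_def velocity[OF t] del: charts_at_iff)
  qed
  moreover have "smooth_on {t\<in>I. \<gamma> t \<in> cdom c} (\<lambda>\<tau>. cmap c (\<gamma> \<tau>))" if c: "c \<in> atlas M" for c
  proof -
    let ?J = "{t\<in>I. \<gamma> t \<in> cdom c}" and ?E = "\<lambda>b. coord_vec M c b"
    let ?G = "\<lambda>b b' y. (-1) *\<^sub>R nab (?E b) (cinv c y) (?E b' (cinv c y)) c"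
    let ?w = "\<lambda>t. velocity M \<gamma> t c"
    note Oc = chart_openin[OF smooth_M c] and E = coord_vec_smooth[OF smooth_M c]
    have O: "open (cmap c ` cdom c)" using smooth_M c by (simp add: smooth_manifold_def)
    have "{t\<in>I. \<gamma> t \<in> pts S \<inter> cdom c} = ?J" using \<gamma>S by auto
    then have J: "open ?J" using integral_curve_preimage_open[OF \<gamma> openin_restrict[OF Oc]] by simp
    show ?thesis
    proof (rule smooth_on_quadratic_ode[OF J, of _ "cmap c ` cdom c" ?G ?w])
      show "(\<lambda>\<tau>. cmap c (\<gamma> \<tau>)) ` ?J \<subseteq> cmap c ` cdom c" by auto
      show "smooth_on (cmap c ` cdom c) (?G b b')" for b b'
        by (intro smooth_on_scaleR O smooth_vf_component(1)[OF smooth_M c Oc order_refl nab_smooth[OF affine Oc E E]])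
          (simp add: smooth_on_def)
      fix t assume "t \<in> ?J"
      then have t: "t \<in> I" and ct: "c \<in> charts_at M (\<gamma> t)" "\<gamma> t \<in> cdom c" using c by auto
      show "((\<lambda>\<tau>. cmap c (\<gamma> \<tau>)) has_vector_derivative ?w t) (at t)"
        using deriv[OF t ct(1)] by (simp add: velocity[OF t])
      let ?v = "velocity M \<gamma> t"
      have v: "?v \<in> tangent_space M (\<gamma> t)" using W[OF \<gamma>S[OF t]] by (simp only: velocity[OF t])
      have "nab (?E (?v c)) (\<gamma> t) ?v c = (\<Sum>b\<in>Basis. (?v c \<bullet> b) *\<^sub>R nab (?E b) (\<gamma> t) ?v c)"
        using linear_basis_expansion[OF nab_coord_vec_linear[OF smooth_M affine ct(1) v]] by simp
      also have "\<dots> = (\<Sum>b\<in>Basis. (?v c \<bullet> b) *\<^sub>R nab (?E b) (\<gamma> t) (?E (?v c) (\<gamma> t)) c)"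
        using tangent_eq_coord_vec[OF smooth_M ct(1) v] by simp
      also have "\<dots> = (\<Sum>b\<in>Basis. (?v c \<bullet> b) *\<^sub>R (\<Sum>b'\<in>Basis. (?v c \<bullet> b') *\<^sub>R nab (?E b) (\<gamma> t) (?E b' (\<gamma> t)) c))"
        by (simp only: linear_basis_expansion[OF nab_dir_linear[OF ct(1) Oc E ct(2)]])
      finally have "- nab (?E (?v c)) (\<gamma> t) ?v c =
         (\<Sum>b\<in>Basis. \<Sum>b'\<in>Basis. (?w t \<bullet> b) *\<^sub>R (?w t \<bullet> b') *\<^sub>R ?G b b' (cmap c (\<gamma> t)))"
        using chart_cinv[OF smooth_M c ct(2)] by (simp add: scaleR_sum_right sum_negf)
      then show "(?w has_vector_derivative
         (\<Sum>b\<in>Basis. \<Sum>b'\<in>Basis. (?w t \<bullet> b) *\<^sub>R (?w t \<bullet> b') *\<^sub>R ?G b b' (cmap c (\<gamma> t)))) (at t)"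
        using deriv2[OF t ct(1)] by (simp only: velocity[OF t])
    qed
  qed
  ultimately show ?thesis using I \<gamma>M by (simp add: geodesic_def)
qed

end

theorem theorem3p8:
  fixes M :: "('m, 'e::euclidean_space) mfd"
    and g :: "('m, 'e) metric"
    and nab :: "('m, 'e) connection"
    and S :: "('m, real^'n) mfd"
    and N V :: "'m \<Rightarrow> ('m, 'e) tvec"
    and \<theta> :: "'m \<Rightarrow> real"
  assumes "riemannian_manifold M g"
    and "levi_civita M g nab"
    and "PA_hypersurface M g S N V \<theta>"
    and "\<not> totally_geodesic M nab S N"
    and "parallel_along M nab S V"
    and "\<theta> constant_on pts S"
  shows "(\<forall>I \<gamma>. integral_curve S (tangential_component M S N V \<theta>) I \<gamma> \<longrightarrow> geodesic M nab I \<gamma>) \<and>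
    (\<forall>p\<in>pts S. endo_det S p (shape_operator M nab S N p) = 0)"
proof -
  note PA = assms(3)[unfolded PA_hypersurface_def]
  obtain k where k: "\<And>p. p \<in> pts S \<Longrightarrow> cos (\<theta> p) = k"
    using assms(6) unfolding constant_on_def by metis
  interpret parallel_constant_angle M g nab S N V k
    by unfold_locales (use assms PA k in auto)
  have V_unit: "g p (V p) (V p) = 1" if "p \<in> pts S" for p using PA that by blast
  let ?T = "tangential_component M S N V \<theta>"
  have T: "?T p \<in> tangent_space S p" "incl S M p (?T p) = V p - k \<odot> N p" if p: "p \<in> pts S" for p
  proof -
    obtain \<tau> where \<tau>: "\<tau> \<in> tangent_space S p" "incl S M p \<tau> = V p - k \<odot> N p"
      using tangential_part_exists[OF p] .
    have "?T p = \<tau>"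
      unfolding tangential_component_def
    proof (rule the_equality)
      show "\<tau> \<in> tangent_space S p \<and> V p = incl S M p \<tau> + cos (\<theta> p) \<odot> N p"
        using \<tau> by (simp add: k[OF p])
      fix \<xi> assume \<xi>: "\<xi> \<in> tangent_space S p \<and> V p = incl S M p \<xi> + cos (\<theta> p) \<odot> N p"
      then have "incl S M p \<xi> = V p - cos (\<theta> p) \<odot> N p" by (metis add_diff_cancel_right')
      then show "\<xi> = \<tau>" using incl_inject[OF p _ \<tau>(1), of \<xi>] \<tau>(2) \<xi> k[OF p] by simp
    qed
    then show "?T p \<in> tangent_space S p" "incl S M p (?T p) = V p - k \<odot> N p" using \<tau> by simp_all
  qed
  have "k \<noteq> 1"
    using assms(4) parallel_normal_shape_operator[OF V_unit] unfolding totally_geodesic_def by blast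
  \<comment> \<open>a zero of the tangential component would force \<open>k = 1\<close>\<close>
  have nonzero: "?T p \<noteq> 0" if p: "p \<in> pts S" for p
  proof
    assume "?T p = 0"
    then have "V p = k \<odot> N p" using T(2)[OF p] incl_zero[OF p] by simp
    then have "k * k = 1"
      using V_unit[OF p] V_angle[OF p] N_unit[OF p]
      by (metis metric_scale_left metric_scale_right riem pts_S_M[OF p] N_tangent[OF p] V_tangent[OF p])
    \<comment> \<open>excludes \<open>V = - N\<close>, where \<open>k = - 1\<close>\<close>
    moreover have "k \<ge> 0"
      using PA p k[OF p] cos_ge_zero[of "\<theta> p"] by force
    ultimately show False using \<open>k \<noteq> 1\<close> by (simp add: square_eq_1_iff)
  qed
  have "endo_det S p (shape_operator M nab S N p) = 0" if p: "p \<in> pts S" for p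
  proof (rule endo_det_eq_0[OF smooth_S p])
    show "?T p \<in> tangent_space S p" "?T p \<noteq> 0" using T(1)[OF p] nonzero[OF p] .
    show "shape_operator M nab S N p (?T p) = 0" by (rule shape_operator_tangential_part[OF p T[OF p]])
  qed (rule shape_operator_linear)
  moreover have "geodesic M nab I \<gamma>" if "integral_curve S ?T I \<gamma>" for I \<gamma>
    by (rule integral_curve_geodesic[of ?T, OF T that])
  ultimately show ?thesis by blast
qed

end
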